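(* Let $S$ be a finite set, let $P$ be an irreducible stochastic matrix on $S$ with stationary distribution $\pi$, and let $f:S\to[a,b]$, where $a:=\min_{x} f(x)$ and $b:=\max_{x} f(x)$. Put $S_a:=\{x\in S:f(x)=a\}$ and $S_b:=\{x\in S: f(x)=b\}$. Assume that the submatrix of $P$ with rows and columns in $S_b$ is irreducible; that for every $x\in S\setminus S_b$ there exists $y\in S_b$ with $P(x,y)>0$; that the submatrix of $P$ with rows and columns in $S_a$ is irreducible; and that for every $x\in S\setminus S_a$ there exists $y\in S_a$ with $P(x,y)>0$. Then $$\Lambda(\theta)\le\pi(f)\theta+\frac12\sigma^2\theta^2\le\pi(f)\theta+\frac{(b-a+2KL)^2}{8}\theta^2,\quad\text{for any }\theta\in\mathbb{R},$$ where $\sigma^2=\max\{\sigma_u^2(P,f),\sigma_u^2(P,-f)\}$, $K=\max\{K_u(P,f),K_u(P,-f)\}$ and $L=\max\{L_u(P,f),L_u(P,-f)\}$ (all finite).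
   Context: A square nonnegative matrix $A$ is irreducible if for all indices $x,y$ there is $n\ge1$ with $A^n(x,y)>0$ (in particular the $1\times1$ zero matrix is not irreducible). $\pi(f):=\sum_x f(x)\pi(x)$. For $\theta\in\mathbb{R}$ let $\tilde P_\theta(x,y):=P(x,y)e^{\theta f(y)}$, which is nonnegative and irreducible; let $\rho(\theta)$ be its spectral radius, and let $u_\theta,v_\theta$ be the unique entrywise positive left and right eigenvectors of $\tilde P_\theta$ for $\rho(\theta)$ with $\sum_x u_\theta(x)=1$ and $\sum_x u_\theta(x)v_\theta(x)=1$. $\Lambda(\theta):=\log\rho(\theta)$. Define $\sigma_u^2(P,f):=\sup_{\theta\ge0}\Lambda''(\theta)$, $K_u(P,f):=\sup_{\theta\ge 0,\;x,y\in S}\frac{v_\theta(x)}{v_\theta(y)}$, $L_u(P,f):=\sup_{\theta\ge 0,\;x,y\in S}\left|\frac{d}{d\theta}\frac{v_\theta(x)}{v_\theta(y)}\right|$; the quantities $\sigma_u^2(P,-f)$, $K_u(P,-f)$, $L_u(P,-f)$ are obtained by replacing $f$ by $-f$ throughout these definitions. *)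

theory Defs
  imports "HOL-Analysis.Analysis"
begin

(* The (x,y) entry of the n-th power of the submatrix of A with rows and columns in T.
   (On real^'s^'s, the library's ^ is the componentwise power.) *)
primrec submatrix_power :: "'s set \<Rightarrow> real^'s::finite^'s \<Rightarrow> nat \<Rightarrow> 's \<Rightarrow> 's \<Rightarrow> real" where
  "submatrix_power T A 0 x y = (if x = y then 1 else 0)"
| "submatrix_power T A (Suc n) x y = (\<Sum>z\<in>T. A $ x $ z * submatrix_power T A n z y)"

definition irreducible_on :: "'s set \<Rightarrow> real^'s::finite^'s \<Rightarrow> bool" where
  "irreducible_on T A \<longleftrightarrow>
     (\<forall>x\<in>T. \<forall>y\<in>T. A $ x $ y \<ge> 0) \<and>
     (\<forall>x\<in>T. \<forall>y\<in>T. \<exists>n\<ge>1. submatrix_power T A n x y > 0)"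

definition stochastic :: "real^'s::finite^'s \<Rightarrow> bool" where
  "stochastic P \<longleftrightarrow> (\<forall>x y. P $ x $ y \<ge> 0) \<and> (\<forall>x. (\<Sum>y\<in>UNIV. P $ x $ y) = 1)"

definition stationary :: "real^'s::finite^'s \<Rightarrow> real^'s \<Rightarrow> bool" where
  "stationary P \<pi> \<longleftrightarrow> (\<forall>x. \<pi> $ x \<ge> 0) \<and> (\<Sum>x\<in>UNIV. \<pi> $ x) = 1 \<and> \<pi> v* P = \<pi>"

definition mean :: "real^'s::finite \<Rightarrow> ('s \<Rightarrow> real) \<Rightarrow> real" where
  "mean \<pi> f = (\<Sum>x\<in>UNIV. f x * \<pi> $ x)"

definition spectrum :: "real^'s::finite^'s \<Rightarrow> complex set" where
  "spectrum A = {c. \<exists>v. v \<noteq> 0 \<and> map_matrix complex_of_real A *v v = c *s v}"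

definition spectral_radius :: "real^'s::finite^'s \<Rightarrow> real" where
  "spectral_radius A = Sup (cmod ` spectrum A)"

definition tilted :: "real^'s::finite^'s \<Rightarrow> ('s \<Rightarrow> real) \<Rightarrow> real \<Rightarrow> real^'s^'s" where
  "tilted P f \<theta> = (\<chi> x y. P $ x $ y * exp (\<theta> * f y))"

definition Lambda :: "real^'s::finite^'s \<Rightarrow> ('s \<Rightarrow> real) \<Rightarrow> real \<Rightarrow> real" where
  "Lambda P f \<theta> = ln (spectral_radius (tilted P f \<theta>))"

(* The two descriptions below are meant for irreducible nonnegative matrices, where
   Perron-Frobenius theory makes them well defined. *)
definition left_perron :: "real^'s::finite^'s \<Rightarrow> real^'s" where
  "left_perron A = (THE u. (\<forall>x. u $ x > 0) \<and> u v* A = spectral_radius A *s u \<and>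
                           (\<Sum>x\<in>UNIV. u $ x) = 1)"

definition right_perron :: "real^'s::finite^'s \<Rightarrow> real^'s" where
  "right_perron A = (THE v. (\<forall>x. v $ x > 0) \<and> A *v v = spectral_radius A *s v \<and>
                            (\<Sum>x\<in>UNIV. left_perron A $ x * v $ x) = 1)"

definition perron_ratio :: "real^'s::finite^'s \<Rightarrow> ('s \<Rightarrow> real) \<Rightarrow> 's \<Rightarrow> 's \<Rightarrow> real \<Rightarrow> real" where
  "perron_ratio P f x y \<theta> =
     right_perron (tilted P f \<theta>) $ x / right_perron (tilted P f \<theta>) $ y"

(* The suprema are taken of these nonempty sets of reals; a supremum is finite exactly
   when the set is bounded above (Sup on the reals is unspecified otherwise). *)
definition var_set :: "real^'s::finite^'s \<Rightarrow> ('s \<Rightarrow> real) \<Rightarrow> real set" where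
  "var_set P f = {deriv (deriv (Lambda P f)) \<theta> | \<theta>. \<theta> \<ge> 0}"

definition K_set :: "real^'s::finite^'s \<Rightarrow> ('s \<Rightarrow> real) \<Rightarrow> real set" where
  "K_set P f = {perron_ratio P f x y \<theta> | \<theta> x y. \<theta> \<ge> 0}"

definition L_set :: "real^'s::finite^'s \<Rightarrow> ('s \<Rightarrow> real) \<Rightarrow> real set" where
  "L_set P f = {\<bar>deriv (perron_ratio P f x y) \<theta>\<bar> | \<theta> x y. \<theta> \<ge> 0}"

definition sigma2_u :: "real^'s::finite^'s \<Rightarrow> ('s \<Rightarrow> real) \<Rightarrow> real" where
  "sigma2_u P f = Sup (var_set P f)"

definition K_u :: "real^'s::finite^'s \<Rightarrow> ('s \<Rightarrow> real) \<Rightarrow> real" where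
  "K_u P f = Sup (K_set P f)"

definition L_u :: "real^'s::finite^'s \<Rightarrow> ('s \<Rightarrow> real) \<Rightarrow> real" where
  "L_u P f = Sup (L_set P f)"

end

(*
  Conjugating the tilted matrix by its right Perron vector v gives a stochastic matrix Q with
  stationary distribution proportional to u v. With w = v'/v, differentiating the eigenvalue equation
  once gives the Poisson equation Lambda' + w = Q (f + w), and a second time shows that Lambda'' is
  the average of the variances of f + w under the rows of Q. Since |w(x) - w(y)| <= K L, Popoviciu's
  inequality gives Lambda'' <= (b - a + K L)^2 / 4, and Taylor's formula at 0 gives the estimate for
  theta >= 0; replacing f by -f handles theta <= 0.

  K and L are finite because every state enters the maximal set of f in one step and that set is
  irreducible, with weights that, after dividing by exp (theta b), do not depend on theta >= 0: a bound
  on v or on w at one point then propagates along paths. Differentiability in theta comes from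
  Cramer's rule, applied to the linear system satisfied by the increments of v and rho.
*)
theory Submission
  imports Defs
begin

subsection \<open>Perron--Frobenius theory\<close>

text \<open>The normalisation of \<open>right_perron\<close> involves the left eigenvector, which
  would have to be differentiated as well. But K and L see only ratios of v, and the variances only
  differences of w, so v is rescaled to be 1 at a base state \<open>r\<close>. Continuity of v has
  to precede differentiability: the equation linking two tilts contains v at the moving tilt.
  Continuity comes from the same linear system as soon as v is known to be locally bounded. The
  delicate range is \<theta> tending to infinity. After division by exp(\<theta> b) only the columns
  in S_b survive in the limit, so the limit matrix is reducible unless f is constant. Entry into S_b
  in one step lets every row still see S_b, and irreducibility of S_b keeps \<rho> of exact order
  exp(\<theta> b). The product K L arises because the derivative of v(x)/v(y) is v(x)/v(y) (w(x) -
  w(y)): multiplying by the inverse ratio, at most K, isolates the difference of w. The 2KL of the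
  statement is then reached from KL by K, L >= 0.\<close>

definition edges :: "real^'s::finite^'s \<Rightarrow> 's rel" where
  "edges A = {(x, y). A $ x $ y > 0}"

definition irred :: "real^'s::finite^'s \<Rightarrow> bool" where
  "irred A \<longleftrightarrow> (\<forall>x y. A $ x $ y \<ge> 0) \<and> (\<forall>x y. (x, y) \<in> (edges A)\<^sup>+)"

text \<open>A positive sum of nonnegative terms has a positive term, which supplies the first edge.
  The reflexive version is carried along because the remaining path may have length 0.\<close>

lemma submatrix_power_pos_imp_path:
  assumes nonneg: "\<And>x y. x \<in> T \<Longrightarrow> y \<in> T \<Longrightarrow> A $ x $ y \<ge> 0"
    and "x \<in> T" "y \<in> T" "submatrix_power T A n x y > 0"
  shows "(x, y) \<in> (edges A \<inter> T \<times> T)\<^sup>* \<and> (n \<ge> 1 \<longrightarrow> (x, y) \<in> (edges A \<inter> T \<times> T)\<^sup>+)"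
  using assms(2-)
proof (induction n arbitrary: x)
  case 0
  then show ?case by (auto split: if_splits)
next
  case (Suc n)
  have "\<exists>z\<in>T. A $ x $ z * submatrix_power T A n z y > 0"
  proof (rule ccontr)
    assume "\<not> ?thesis"
    then have "(\<Sum>z\<in>T. A $ x $ z * submatrix_power T A n z y) \<le> 0"
      by (intro sum_nonpos) (auto simp: not_less)
    then show False using Suc.prems by simp
  qed
  then obtain z where z: "z \<in> T" "A $ x $ z * submatrix_power T A n z y > 0" by blast
  then have p: "A $ x $ z > 0" "submatrix_power T A n z y > 0"
    using nonneg[OF Suc.prems(1) z(1)] by (auto simp: zero_less_mult_iff)
  then have "(z, y) \<in> (edges A \<inter> T \<times> T)\<^sup>*" using Suc z by blast
  moreover have "(x, z) \<in> edges A \<inter> T \<times> T" using p z Suc.prems by (auto simp: edges_def)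
  ultimately have "(x, y) \<in> (edges A \<inter> T \<times> T)\<^sup>+" by (rule rtrancl_into_trancl2[rotated])
  then show ?case by (auto intro: trancl_into_rtrancl)
qed

lemma irreducible_on_path:
  assumes "irreducible_on T A" "x \<in> T" "y \<in> T"
  shows "(x, y) \<in> (edges A \<inter> T \<times> T)\<^sup>+"
proof -
  obtain n where "n \<ge> 1" "submatrix_power T A n x y > 0"
    using assms unfolding irreducible_on_def by blast
  then show ?thesis
    using submatrix_power_pos_imp_path[of T A x y n] assms unfolding irreducible_on_def by blast
qed

lemma irreducible_on_UNIV_irred: "irreducible_on UNIV A \<Longrightarrow> irred A"
  using irreducible_on_path[of UNIV A] unfolding irred_def by (auto simp: irreducible_on_def)

lemma irred_transpose: "irred A \<Longrightarrow> irred (transpose A)"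
proof -
  assume A: "irred A"
  have "edges (transpose A) = (edges A)\<inverse>" by (auto simp: edges_def transpose_def)
  then show ?thesis using A by (auto simp: irred_def trancl_converse transpose_def)
qed

lemma irred_edge:
  assumes "irred A"
  shows "\<exists>y. A $ x $ y > 0"
proof -
  have "(x, x) \<in> (edges A)\<^sup>+" using assms by (simp add: irred_def)
  then obtain y where "(x, y) \<in> edges A" by (blast dest: tranclD)
  then show ?thesis by (auto simp: edges_def)
qed

lemma eigen_nth: "A *v v = \<rho> *s v \<Longrightarrow> (\<Sum>y\<in>UNIV. A $ x $ y * v $ y) = \<rho> * v $ x"
  by (simp add: matrix_vector_mult_def vec_eq_iff)

lemma left_eigen_nth:
  fixes A :: "real^'s::finite^'s"
  shows "u v* A = \<rho> *s u \<Longrightarrow> (\<Sum>x\<in>UNIV. u $ x * A $ x $ y) = \<rho> * u $ y"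
  by (simp add: vector_matrix_mult_def vec_eq_iff)

text \<open>Zeros spread along edges: at a zero the eigenvalue equation is a vanishing sum of
  nonnegative terms, so every successor is a zero too. Both positivity and uniqueness of the Perron
  vector rest on this.\<close>

lemma irred_eigen_zero:
  assumes A: "irred A" and v: "\<And>x. v $ x \<ge> 0" "A *v v = \<rho> *s v" and z: "v $ x = 0"
  shows "v = 0"
proof -
  have "v $ y = 0" for y
  proof -
    have "(x, y) \<in> (edges A)\<^sup>*" using A by (auto simp: irred_def intro: trancl_into_rtrancl)
    then show ?thesis
    proof induction
      case base
      then show ?case using z by simp
    next
      case (step y w)
      have "(\<Sum>z\<in>UNIV. A $ y $ z * v $ z) = 0" using eigen_nth[OF v(2), of y] step by simp
      then have "A $ y $ w * v $ w = 0"
        using A v by (subst (asm) sum_nonneg_eq_0_iff) (auto simp: irred_def)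
      then show ?case using step by (auto simp: edges_def)
    qed
  qed
  then show ?thesis by (simp add: vec_eq_iff)
qed

text \<open>Brouwer's theorem on the probability simplex, for the normalised map v -> Av + v. The
  added v keeps the normalising sum at least 1, so the map is continuous without any prior lower
  bound on Av; it shifts the eigenvalue by 1.\<close>

lemma irred_eigenvector_exists:
  fixes A :: "real^'s::finite^'s"
  assumes A: "irred A"
  shows "\<exists>v \<rho>. (\<forall>x. v $ x > 0) \<and> \<rho> > 0 \<and> A *v v = \<rho> *s v"
proof -
  define S :: "(real^'s) set" where "S = {v. (\<forall>x. v $ x \<ge> 0) \<and> (\<Sum>x\<in>UNIV. v $ x) = 1}"
  define s where "s v = (\<Sum>x\<in>UNIV. (A *v v + v) $ x)" for v :: "real^'s"
  define g where "g v = (1 / s v) *s (A *v v + v)" for v :: "real^'s"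
  have nn: "(A *v v) $ x \<ge> 0" if "v \<in> S" for v x
    using that A by (auto simp: S_def irred_def matrix_vector_mult_def intro!: sum_nonneg)
  have s1: "s v \<ge> 1" if "v \<in> S" for v
  proof -
    have "s v = (\<Sum>x\<in>UNIV. (A *v v) $ x) + 1" using that by (simp add: s_def S_def sum.distrib)
    then show ?thesis using nn[OF that] by (simp add: sum_nonneg)
  qed
  have le1: "norm v \<le> 1" if "v \<in> S" for v
    using norm_le_l1_cart[of v] that by (simp add: S_def)
  have "compact S"
    unfolding compact_eq_bounded_closed
  proof
    show "bounded S" using le1 by (auto simp: bounded_iff)
    show "closed S" unfolding S_def
      by (intro closed_Collect_conj closed_Collect_all closed_Collect_le closed_Collect_eq continuous_intros)
  qed
  moreover have "convex S"
    unfolding convex_def S_def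
    by (auto simp: sum.distrib simp flip: sum_distrib_left)
  moreover have "axis undefined 1 \<in> S" by (auto simp: S_def axis_def)
  then have "S \<noteq> {}" by blast
  moreover have "continuous_on S g"
  proof -
    have "continuous_on S (\<lambda>v. \<chi> x. (1 / s v) * ((A *v v) $ x + v $ x))"
      unfolding s_def matrix_vector_mult_def
      using s1 by (auto intro!: continuous_intros simp: s_def matrix_vector_mult_def) force
    moreover have "g = (\<lambda>v. \<chi> x. (1 / s v) * ((A *v v) $ x + v $ x))"
      by (auto simp: g_def fun_eq_iff vec_eq_iff add_divide_distrib)
    ultimately show ?thesis by simp
  qed
  moreover have "g \<in> S \<rightarrow> S"
  proof
    fix v assume v: "v \<in> S"
    have "(\<Sum>x\<in>UNIV. g v $ x) = s v / s v"
      unfolding g_def vector_smult_component sum_distrib_left[symmetric] s_def[symmetric] by simp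
    then show "g v \<in> S" using s1[OF v] nn[OF v] v by (auto simp: S_def g_def)
  qed
  ultimately obtain v where v: "v \<in> S" "g v = v" by (rule brouwer)
  define \<rho> where "\<rho> = s v - 1"
  have e: "A *v v = \<rho> *s v"
  proof -
    have "(A *v v) $ x = \<rho> * v $ x" for x
    proof -
      have "((A *v v) $ x + v $ x) / s v = v $ x"
        using arg_cong[OF v(2), of "\<lambda>v. v $ x"] by (simp add: g_def add_divide_distrib)
      then show ?thesis using s1[OF v(1)] by (simp add: \<rho>_def field_simps)
    qed
    then show ?thesis by (simp add: vec_eq_iff)
  qed
  have "v \<noteq> 0" using v(1) by (auto simp: S_def)
  moreover have "\<forall>x. v $ x \<ge> 0" using v(1) by (simp add: S_def)
  ultimately have pos: "v $ x > 0" for x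
    using irred_eigen_zero[OF A _ e, of x] by (metis less_eq_real_def)
  obtain x y where "A $ x $ y > 0" using irred_edge[OF A] by blast
  then have "0 < A $ x $ y * v $ y" using pos by simp
  also have "\<dots> \<le> (\<Sum>y\<in>UNIV. A $ x $ y * v $ y)"
    by (rule member_le_sum) (use A pos in \<open>auto simp: irred_def less_imp_le\<close>)
  also have "\<dots> = \<rho> * v $ x" by (rule eigen_nth[OF e])
  finally have "\<rho> > 0" using pos[of x] by (simp add: zero_less_mult_iff)
  then show ?thesis using pos e by blast
qed

text \<open>Associativity of u A w for an arbitrary w. Pairing with a positive left eigenvector is
  the device by which eigenvalues are compared and unknown vectors cancelled throughout.\<close>

lemma left_right_product:
  fixes A :: "real^'s::finite^'s"
  assumes "u v* A = \<rho> *s u"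
  shows "(\<Sum>x\<in>UNIV. u $ x * (\<Sum>y\<in>UNIV. A $ x $ y * w y)) = \<rho> * (\<Sum>y\<in>UNIV. u $ y * w y)"
proof -
  have "(\<Sum>x\<in>UNIV. u $ x * (\<Sum>y\<in>UNIV. A $ x $ y * w y)) = (\<Sum>x\<in>UNIV. \<Sum>y\<in>UNIV. u $ x * A $ x $ y * w y)"
    by (simp add: sum_distrib_left mult.assoc)
  also have "\<dots> = (\<Sum>y\<in>UNIV. (\<Sum>x\<in>UNIV. u $ x * A $ x $ y) * w y)"
    by (subst sum.swap) (simp add: sum_distrib_right)
  also have "\<dots> = \<rho> * (\<Sum>y\<in>UNIV. u $ y * w y)"
    by (simp add: left_eigen_nth[OF assms] sum_distrib_left mult.assoc)
  finally show ?thesis .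
qed

lemma sum_pos_UNIV: "(\<And>x. (f x :: real) > 0) \<Longrightarrow> (\<Sum>x\<in>(UNIV :: 's::finite set). f x) > 0"
  by (rule sum_pos) auto

text \<open>The transpose has a positive eigenvector for some eigenvalue of its own; evaluating u A
  v in two ways identifies it with \<rho>, since the pairing of u and v is positive.\<close>

lemma irred_left_eigenvector:
  fixes A :: "real^'s::finite^'s"
  assumes A: "irred A" and v: "\<And>x. v $ x > 0" "A *v v = \<rho> *s v"
  shows "\<exists>u. (\<forall>x. u $ x > 0) \<and> u v* A = \<rho> *s u"
proof -
  obtain u \<mu> where u: "\<forall>x. u $ x > 0" "transpose A *v u = \<mu> *s u"
    using irred_eigenvector_exists[OF irred_transpose[OF A]] by blast
  then have u': "u v* A = \<mu> *s u" by simp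
  have "(\<Sum>x\<in>UNIV. u $ x * v $ x) > 0" using u v by (intro sum_pos_UNIV) simp
  moreover have "\<rho> * (\<Sum>x\<in>UNIV. u $ x * v $ x) = \<mu> * (\<Sum>y\<in>UNIV. u $ y * v $ y)"
  proof -
    have "(\<Sum>x\<in>UNIV. u $ x * (\<Sum>y\<in>UNIV. A $ x $ y * v $ y)) = \<rho> * (\<Sum>x\<in>UNIV. u $ x * v $ x)"
      unfolding eigen_nth[OF v(2)] by (simp add: sum_distrib_left mult_ac)
    then show ?thesis using left_right_product[OF u', of "($) v"] by metis
  qed
  ultimately have "\<rho> = \<mu>" by simp
  then show ?thesis using u u' by blast
qed

text \<open>Subtract from w the largest multiple of v that leaves it nonnegative. The difference is
  an eigenvector that touches zero somewhere, hence vanishes.\<close>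

lemma irred_eigenspace:
  fixes A :: "real^'s::finite^'s"
  assumes A: "irred A" and v: "\<And>x. v $ x > 0" "A *v v = \<rho> *s v" and w: "A *v w = \<rho> *s w"
  shows "\<exists>t. w = t *s v"
proof -
  define t where "t = Min (range (\<lambda>x. w $ x / v $ x))"
  have "t \<in> range (\<lambda>x. w $ x / v $ x)" unfolding t_def by (rule Min_in) auto
  then obtain x where x: "t = w $ x / v $ x" by blast
  have le: "t \<le> w $ y / v $ y" for y unfolding t_def by simp
  have "w - t *s v = 0"
  proof (rule irred_eigen_zero[OF A])
    show "(w - t *s v) $ y \<ge> 0" for y using le[of y] v(1)[of y] by (simp add: field_simps)
    show "(w - t *s v) $ x = 0" using x v(1)[of x] by simp
    show "A *v (w - t *s v) = \<rho> *s (w - t *s v)"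
      by (simp add: matrix_vector_mult_diff_distrib v w vector_scalar_commute vec_eq_iff algebra_simps)
  qed
  then show ?thesis by auto
qed

text \<open>For any complex eigenvector w the triangle inequality gives |c| |w| <= A |w| entrywise;
  pairing with the positive left eigenvector turns this into |c| <= \<rho>.\<close>

lemma spectral_radius_eqI:
  fixes A :: "real^'s::finite^'s"
  assumes A: "irred A" and v: "\<And>x. v $ x > 0" "A *v v = \<rho> *s v"
  shows "spectral_radius A = \<rho>"
proof -
  obtain u where u: "\<forall>x. u $ x > 0" "u v* A = \<rho> *s u"
    using irred_left_eigenvector[OF A v] by blast
  have "(\<Sum>y\<in>UNIV. A $ x $ y * v $ y) \<ge> 0" for x
    using A v(1) by (intro sum_nonneg) (auto simp: irred_def less_imp_le)
  \<comment> \<open>The spectrum is measured by moduli, so \<rho> is recognised in the image of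
    \<open>cmod\<close> only once its sign is known.\<close>
  then have l0: "\<rho> \<ge> 0" using eigen_nth[OF v(2)] v(1)
    by (metis mult_less_0_iff not_less)
  have "complex_of_real \<rho> \<in> spectrum A"
  proof -
    define w :: "complex^'s" where "w = (\<chi> x. complex_of_real (v $ x))"
    have "map_matrix complex_of_real A *v w = complex_of_real \<rho> *s w"
    proof -
      have "(\<Sum>y\<in>UNIV. complex_of_real (A $ x $ y) * complex_of_real (v $ y)) =
        complex_of_real \<rho> * complex_of_real (v $ x)" for x
        using arg_cong[OF eigen_nth[OF v(2), of x], of complex_of_real] by simp
      then show ?thesis
        by (simp add: vec_eq_iff matrix_vector_mult_def map_matrix_def w_def)
    qed
    moreover have "w \<noteq> 0" using v(1) by (auto simp: w_def vec_eq_iff less_imp_neq[symmetric])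
    ultimately show ?thesis unfolding spectrum_def by blast
  qed
  then have in1: "\<rho> \<in> cmod ` spectrum A"
    using l0 by (metis image_eqI norm_of_real abs_of_nonneg)
  have le: "cmod c \<le> \<rho>" if "c \<in> spectrum A" for c
  proof -
    have "\<exists>w. w \<noteq> 0 \<and> map_matrix complex_of_real A *v w = c *s w"
      using that by (simp add: spectrum_def)
    then obtain w where w: "w \<noteq> 0" "map_matrix complex_of_real A *v w = c *s w" by (elim exE conjE) rule
    have 1: "cmod c * cmod (w $ x) \<le> (\<Sum>y\<in>UNIV. A $ x $ y * cmod (w $ y))" for x
    proof -
      have "c * w $ x = (\<Sum>y\<in>UNIV. complex_of_real (A $ x $ y) * w $ y)"
        using arg_cong[OF w(2), of "\<lambda>w. w $ x"]
        by (simp add: matrix_vector_mult_def map_matrix_def)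
      then have "cmod c * cmod (w $ x) = cmod (\<Sum>y\<in>UNIV. complex_of_real (A $ x $ y) * w $ y)"
        by (metis norm_mult)
      also have "\<dots> \<le> (\<Sum>y\<in>UNIV. cmod (complex_of_real (A $ x $ y) * w $ y))" by (rule norm_sum)
      also have "\<dots> = (\<Sum>y\<in>UNIV. A $ x $ y * cmod (w $ y))"
        using A by (auto simp: norm_mult irred_def intro!: sum.cong)
      finally show ?thesis .
    qed
    let ?s = "\<Sum>x\<in>UNIV. u $ x * cmod (w $ x)"
    have "cmod c * ?s = (\<Sum>x\<in>UNIV. u $ x * (cmod c * cmod (w $ x)))"
      by (simp add: sum_distrib_left mult_ac)
    also have "\<dots> \<le> (\<Sum>x\<in>UNIV. u $ x * (\<Sum>y\<in>UNIV. A $ x $ y * cmod (w $ y)))"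
      using 1 u by (intro sum_mono mult_left_mono) (auto simp: less_imp_le)
    also have "\<dots> = \<rho> * ?s" by (rule left_right_product[OF u(2)])
    finally have "cmod c * ?s \<le> \<rho> * ?s" .
    moreover have "?s > 0"
    proof -
      obtain x where "w $ x \<noteq> 0" using w(1) by (auto simp: vec_eq_iff)
      then show ?thesis using u
        by (intro sum_pos2[of _ x]) (auto simp: less_imp_le)
    qed
    ultimately show ?thesis by simp
  qed
  show ?thesis unfolding spectral_radius_def
    using in1 le by (intro cSup_eq_maximum) auto
qed

lemma spectral_radius_pos:
  fixes A :: "real^'s::finite^'s"
  assumes A: "irred A"
  shows "spectral_radius A > 0"
  using irred_eigenvector_exists[OF A] spectral_radius_eqI[OF A] by metis

lemma left_perron:
  fixes A :: "real^'s::finite^'s"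
  assumes A: "irred A"
  shows "left_perron A $ x > 0" "left_perron A v* A = spectral_radius A *s left_perron A"
proof -
  obtain v \<rho> where v: "\<And>x. v $ x > 0" "A *v v = \<rho> *s v"
    using irred_eigenvector_exists[OF A] by blast
  have sr: "spectral_radius A = \<rho>" by (rule spectral_radius_eqI[OF A v])
  obtain u where u: "\<forall>x. u $ x > 0" "u v* A = \<rho> *s u"
    using irred_left_eigenvector[OF A v] by blast
  define s where "s = (\<Sum>x\<in>UNIV. u $ x)"
  have s: "s > 0" unfolding s_def using u by (intro sum_pos_UNIV) simp
  define u' where "u' = (1 / s) *s u"
  have u': "\<forall>x. u' $ x > 0" "u' v* A = \<rho> *s u'" "(\<Sum>x\<in>UNIV. u' $ x) = 1"
    using u s by (auto simp: u'_def s_def vec_eq_iff vector_matrix_mult_def sum_divide_distrib[symmetric]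
        left_eigen_nth[OF u(2)])
  have "left_perron A = u'"
    unfolding left_perron_def sr
  proof (rule the_equality)
    show "(\<forall>x. u' $ x > 0) \<and> u' v* A = \<rho> *s u' \<and> (\<Sum>x\<in>UNIV. u' $ x) = 1" using u' by blast
    fix w assume w: "(\<forall>x. w $ x > 0) \<and> w v* A = \<rho> *s w \<and> (\<Sum>x\<in>UNIV. w $ x) = 1"
    then obtain t where t: "w = t *s u'"
      using irred_eigenspace[OF irred_transpose[OF A], of u' \<rho> w] u' by auto
    then have "t = 1" using w u'(3) by (simp flip: sum_distrib_left)
    then show "w = u'" using t by simp
  qed
  then show "left_perron A $ x > 0" "left_perron A v* A = spectral_radius A *s left_perron A"
    using u' sr by auto
qed

lemma right_perron:
  fixes A :: "real^'s::finite^'s"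
  assumes A: "irred A"
  shows "right_perron A $ x > 0" "A *v right_perron A = spectral_radius A *s right_perron A"
proof -
  obtain v \<rho> where v: "\<And>x. v $ x > 0" "A *v v = \<rho> *s v"
    using irred_eigenvector_exists[OF A] by blast
  have sr: "spectral_radius A = \<rho>" by (rule spectral_radius_eqI[OF A v])
  define s where "s = (\<Sum>x\<in>UNIV. left_perron A $ x * v $ x)"
  have s: "s > 0" unfolding s_def using v left_perron[OF A] by (intro sum_pos_UNIV) simp
  define v' where "v' = (1 / s) *s v"
  have v': "\<forall>x. v' $ x > 0" "A *v v' = \<rho> *s v'" "(\<Sum>x\<in>UNIV. left_perron A $ x * v' $ x) = 1"
  proof -
    show "\<forall>x. v' $ x > 0" using v s by (simp add: v'_def)
    show "A *v v' = \<rho> *s v'" unfolding v'_def vector_scalar_commute v(2) by (simp add: vec_eq_iff)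
    show "(\<Sum>x\<in>UNIV. left_perron A $ x * v' $ x) = 1"
      using s by (simp add: v'_def s_def flip: sum_divide_distrib)
  qed
  have "right_perron A = v'"
    unfolding right_perron_def sr
  proof (rule the_equality)
    show "(\<forall>x. v' $ x > 0) \<and> A *v v' = \<rho> *s v' \<and> (\<Sum>x\<in>UNIV. left_perron A $ x * v' $ x) = 1"
      using v' by blast
    fix w assume w: "(\<forall>x. w $ x > 0) \<and> A *v w = \<rho> *s w \<and> (\<Sum>x\<in>UNIV. left_perron A $ x * w $ x) = 1"
    then obtain t where t: "w = t *s v'"
      using irred_eigenspace[OF A, of v' \<rho> w] v' by auto
    have "(\<Sum>x\<in>UNIV. left_perron A $ x * w $ x) = t * (\<Sum>x\<in>UNIV. left_perron A $ x * v' $ x)"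
      by (simp add: t sum_distrib_left mult_ac)
    then have "t = 1" using w v'(3) by simp
    then show "w = v'" using t by simp
  qed
  then show "right_perron A $ x > 0" "A *v right_perron A = spectral_radius A *s right_perron A"
    using v' sr by auto
qed

subsection \<open>Propagation of bounds along paths\<close>

text \<open>A Harnack chain. \<open>C\<close> is chosen before \<open>d\<close> and
  \<open>D\<close>, so it serves all tilts at once. \<open>D\<close> is 0 for bounds on v and
  absorbs the inhomogeneous term of the Poisson equation for bounds on w.\<close>

lemma rtrancl_affine_bound_aux:
  fixes c :: real
  assumes c: "c \<ge> 0" and "(x, y) \<in> E\<^sup>*"
  shows "\<exists>C\<ge>0. \<forall>d D. D \<ge> 0 \<longrightarrow> (\<forall>x. d x \<ge> 0) \<longrightarrow>
    (\<forall>x y. (x, y) \<in> E \<longrightarrow> d y \<le> c * (d x + D)) \<longrightarrow> d y \<le> C * (d x + D)"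
  using assms(2)
proof induction
  case base
  show ?case by (rule exI[of _ 1]) auto
next
  case (step y z)
  then obtain C where C: "C \<ge> 0" "\<And>d D. D \<ge> 0 \<Longrightarrow> (\<And>x. d x \<ge> 0) \<Longrightarrow>
    (\<And>x y. (x, y) \<in> E \<Longrightarrow> d y \<le> c * (d x + D)) \<Longrightarrow> d y \<le> C * (d x + D)" by auto
  show ?case
  proof (intro exI[of _ "c * (C + 1)"] conjI allI impI)
    show "0 \<le> c * (C + 1)" using c C by simp
    fix d :: "'a \<Rightarrow> real" and D :: real
    assume h: "0 \<le> D" "\<forall>x. 0 \<le> d x" "\<forall>x y. (x, y) \<in> E \<longrightarrow> d y \<le> c * (d x + D)"
    have "d z \<le> c * (d y + D)" using h step by blast
    also have "\<dots> \<le> c * (C * (d x + D) + (d x + D))"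
    proof (intro mult_left_mono c add_mono)
      show "d y \<le> C * (d x + D)" using C(2)[of D d] h by blast
      show "D \<le> d x + D" using h by simp
    qed
    also have "\<dots> = c * (C + 1) * (d x + D)" by (simp add: algebra_simps)
    finally show "d z \<le> c * (C + 1) * (d x + D)" .
  qed
qed

lemma rtrancl_affine_bound:
  fixes c :: real and E :: "'s::finite rel"
  assumes c: "c \<ge> 0"
  obtains C where "C \<ge> 0" "\<And>d D x y. D \<ge> 0 \<Longrightarrow> (\<And>x. d x \<ge> 0) \<Longrightarrow>
    (\<And>x y. (x, y) \<in> E \<Longrightarrow> d y \<le> c * (d x + D)) \<Longrightarrow> (x, y) \<in> E\<^sup>* \<Longrightarrow> d y \<le> C * (d x + D)"
proof -
  have "\<forall>p. \<exists>C. p \<in> E\<^sup>* \<longrightarrow> C \<ge> 0 \<and> (\<forall>d D. D \<ge> 0 \<longrightarrow> (\<forall>x. d x \<ge> 0) \<longrightarrow>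
    (\<forall>x y. (x, y) \<in> E \<longrightarrow> d y \<le> c * (d x + D)) \<longrightarrow> d (snd p) \<le> C * (d (fst p) + D))"
    using rtrancl_affine_bound_aux[OF c] by (auto simp: split_paired_All)
  then obtain C where C: "\<And>p. p \<in> E\<^sup>* \<Longrightarrow> C p \<ge> 0 \<and> (\<forall>d D. D \<ge> 0 \<longrightarrow> (\<forall>x. d x \<ge> 0) \<longrightarrow>
    (\<forall>x y. (x, y) \<in> E \<longrightarrow> d y \<le> c * (d x + D)) \<longrightarrow> d (snd p) \<le> C p * (d (fst p) + D))"
    by metis
  \<comment> \<open>There are finitely many pairs with nonnegative constants, so their sum dominates
    each one.\<close>
  define C0 where "C0 = (\<Sum>p\<in>E\<^sup>*. C p)"
  have C0: "C p \<le> C0" if "p \<in> E\<^sup>*" for p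
    unfolding C0_def using that C by (intro member_le_sum) auto
  show thesis
  proof
    show "C0 \<ge> 0" unfolding C0_def using C by (intro sum_nonneg) auto
    fix d :: "'s \<Rightarrow> real" and D x y
    assume h: "0 \<le> D" "\<And>x. 0 \<le> d x" "\<And>x y. (x, y) \<in> E \<Longrightarrow> d y \<le> c * (d x + D)" "(x, y) \<in> E\<^sup>*"
    then have "d y \<le> C (x, y) * (d x + D)" using C[OF h(4)] by auto
    also have "\<dots> \<le> C0 * (d x + D)" using C0[OF h(4)] h(1) h(2)[of x] by (intro mult_right_mono) auto
    finally show "d y \<le> C0 * (d x + D)" .
  qed
qed

subsection \<open>Smoothness of the Perron eigenvalue and eigenvector\<close>

lemma det_differentiable:
  fixes M :: "real \<Rightarrow> real^'n^'n"
  assumes "\<And>i j. (\<lambda>t. M t $ i $ j) differentiable (at t)"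
  shows "(\<lambda>t. det (M t)) differentiable (at t)"
proof -
  obtain D where D: "\<And>i j. ((\<lambda>t. M t $ i $ j) has_real_derivative D i j) (at t)"
    using assms unfolding real_differentiable_def by metis
  have "(\<lambda>t. of_int (sign p) * (\<Prod>i\<in>UNIV. M t $ i $ p i)) differentiable (at t)" for p
    unfolding real_differentiable_def
    by (rule exI, rule DERIV_cmult, rule has_field_derivative_prod, rule D)
  then show ?thesis unfolding det_def by (intro differentiable_sum) auto
qed

lemma tendsto_det:
  fixes M :: "'a \<Rightarrow> real^'n^'n"
  assumes "\<And>i j. ((\<lambda>t. M t $ i $ j) \<longlongrightarrow> N $ i $ j) F"
  shows "((\<lambda>t. det (M t)) \<longlongrightarrow> det N) F"
  unfolding det_def by (intro tendsto_intros assms)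

locale tilted_chain =
  fixes P :: "real^'s::finite^'s" and f :: "'s \<Rightarrow> real" and r :: 's
  assumes stoch: "stochastic P" and irr: "irreducible_on UNIV P"
begin

definition A :: "real \<Rightarrow> 's \<Rightarrow> 's \<Rightarrow> real" where "A \<theta> x y = P $ x $ y * exp (\<theta> * f y)"
definition rho :: "real \<Rightarrow> real" where "rho \<theta> = spectral_radius (tilted P f \<theta>)"
text \<open>Right Perron vector scaled to be 1 at \<open>r\<close>; as a ratio it does not depend on
  the normalisation chosen in \<open>right_perron\<close>.\<close>

definition v :: "real \<Rightarrow> 's \<Rightarrow> real" where "v \<theta> x = perron_ratio P f x r \<theta>"

lemma P_nonneg: "P $ x $ y \<ge> 0" and P_row: "(\<Sum>y\<in>UNIV. P $ x $ y) = 1"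
  using stoch by (auto simp: stochastic_def)

lemma tilted_nth [simp]: "tilted P f \<theta> $ x $ y = A \<theta> x y"
  by (simp add: tilted_def A_def)

lemma A_nonneg: "A \<theta> x y \<ge> 0"
  by (simp add: A_def P_nonneg)

lemma irred_P: "irred P" by (rule irreducible_on_UNIV_irred[OF irr])

lemma path_P: "(x, y) \<in> (edges P)\<^sup>*"
  using irred_P by (simp add: irred_def trancl_into_rtrancl)

lemma irred_tilted: "irred (tilted P f \<theta>)"
proof -
  have "edges (tilted P f \<theta>) = edges P" by (simp add: edges_def A_def zero_less_mult_iff)
  then show ?thesis using irred_P by (simp add: irred_def A_nonneg)
qed

lemma rho_pos: "rho \<theta> > 0"
  unfolding rho_def by (rule spectral_radius_pos[OF irred_tilted])

lemma v_pos: "v \<theta> x > 0"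
  unfolding v_def perron_ratio_def using right_perron(1)[OF irred_tilted] by (rule divide_pos_pos) (rule right_perron(1)[OF irred_tilted])

lemma v_nz [simp]: "v \<theta> x \<noteq> 0" using v_pos[of \<theta> x] by simp

lemma v_root: "v \<theta> r = 1"
  unfolding v_def perron_ratio_def using right_perron(1)[OF irred_tilted, of \<theta> r] by simp

lemma perron_ratio_eq: "perron_ratio P f x y \<theta> = v \<theta> x / v \<theta> y"
  unfolding v_def perron_ratio_def using right_perron(1)[OF irred_tilted, of \<theta> r] by simp

lemma v_eigen: "(\<Sum>y\<in>UNIV. A \<theta> x y * v \<theta> y) = rho \<theta> * v \<theta> x"
  using eigen_nth[OF right_perron(2)[OF irred_tilted], of \<theta> x] right_perron(1)[OF irred_tilted, of \<theta> r]
  unfolding v_def perron_ratio_def rho_def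
  by (simp add: sum_divide_distrib[symmetric])

lemma v_eigen_vec: "tilted P f \<theta> *v (\<chi> x. v \<theta> x) = rho \<theta> *s (\<chi> x. v \<theta> x)"
  by (simp add: vec_eq_iff matrix_vector_mult_def v_eigen)

lemma eigenspace:
  assumes "\<And>x. (\<Sum>y\<in>UNIV. A \<theta> x y * w y) = rho \<theta> * w x"
  shows "w x = w r * v \<theta> x"
proof -
  obtain t where t: "(\<chi> x. w x) = t *s (\<chi> x. v \<theta> x)"
    using irred_eigenspace[OF irred_tilted, of "\<chi> x. v \<theta> x" \<theta> "rho \<theta>" "\<chi> x. w x"] v_pos v_eigen_vec assms
    by (auto simp: vec_eq_iff matrix_vector_mult_def)
  then have "w x = t * v \<theta> x" for x by (simp add: vec_eq_iff)
  then show ?thesis using v_root by simp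
qed

lemma left_eigenvector:
  obtains u where "\<And>x. u x > 0"
    "\<And>w. (\<Sum>x\<in>UNIV. u x * (\<Sum>y\<in>UNIV. A \<theta> x y * w y)) = rho \<theta> * (\<Sum>x\<in>UNIV. u x * w x)"
proof (rule that)
  show "left_perron (tilted P f \<theta>) $ x > 0" for x by (rule left_perron(1)[OF irred_tilted])
  show "(\<Sum>x\<in>UNIV. left_perron (tilted P f \<theta>) $ x * (\<Sum>y\<in>UNIV. A \<theta> x y * w y))
    = rho \<theta> * (\<Sum>x\<in>UNIV. left_perron (tilted P f \<theta>) $ x * w x)" for w
    using left_right_product[OF left_perron(2)[OF irred_tilted], of \<theta> w] by (simp add: rho_def)
qed

section \<open>A priori bounds, uniform over bounded ranges of the tilt\<close>

lemma P_lower: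
  obtains p where "p > 0" "\<And>x y. P $ x $ y > 0 \<Longrightarrow> p \<le> P $ x $ y"
proof
  let ?S = "insert 1 ((\<lambda>(x, y). P $ x $ y) ` {(x, y). P $ x $ y > 0})"
  show "Min ?S > 0" by (subst Min_gr_iff) auto
  show "Min ?S \<le> P $ x $ y" if "P $ x $ y > 0" for x y
    using that by (intro Min_le) auto
qed

lemma f_bound: obtains F where "F \<ge> 0" "\<And>x. \<bar>f x\<bar> \<le> F"
proof
  show "(\<Sum>x\<in>UNIV. \<bar>f x\<bar>) \<ge> 0" by (simp add: sum_nonneg)
  show "\<bar>f x\<bar> \<le> (\<Sum>x\<in>UNIV. \<bar>f x\<bar>)" for x by (rule member_le_sum) auto
qed

lemma A_le_A:
  assumes "\<And>x. \<bar>f x\<bar> \<le> F"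
  shows "A \<theta> x y \<le> exp (\<bar>\<theta> - \<eta>\<bar> * F) * A \<eta> x y"
proof -
  have "\<theta> * f y - \<eta> * f y \<le> \<bar>(\<theta> - \<eta>) * f y\<bar>" by (simp add: algebra_simps)
  also have "\<dots> \<le> \<bar>\<theta> - \<eta>\<bar> * F" unfolding abs_mult using assms by (intro mult_left_mono) auto
  finally have "exp (\<theta> * f y) \<le> exp (\<bar>\<theta> - \<eta>\<bar> * F) * exp (\<eta> * f y)" unfolding exp_add[symmetric] by simp
  then show ?thesis unfolding A_def using P_nonneg[of x y] mult_left_mono by (fastforce simp: mult_ac)
qed

text \<open>Pairs the left eigenvector at \<eta> with the right eigenvector at \<theta>, so that the
  entrywise comparison of the two matrices passes to the eigenvalues.\<close>

lemma rho_le_rho: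
  assumes F: "\<And>x. \<bar>f x\<bar> \<le> F"
  shows "rho \<theta> \<le> exp (\<bar>\<theta> - \<eta>\<bar> * F) * rho \<eta>"
proof -
  obtain u where u: "\<And>x. u x > 0"
    "\<And>w. (\<Sum>x\<in>UNIV. u x * (\<Sum>y\<in>UNIV. A \<eta> x y * w y)) = rho \<eta> * (\<Sum>x\<in>UNIV. u x * w x)"
    using left_eigenvector[of \<eta>] by blast
  have Z: "(\<Sum>x\<in>UNIV. u x * v \<theta> x) > 0" by (intro sum_pos_UNIV mult_pos_pos u v_pos)
  have "rho \<theta> * (\<Sum>x\<in>UNIV. u x * v \<theta> x) = (\<Sum>x\<in>UNIV. u x * (\<Sum>y\<in>UNIV. A \<theta> x y * v \<theta> y))"
    by (simp add: v_eigen sum_distrib_left mult_ac)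
  also have "\<dots> \<le> (\<Sum>x\<in>UNIV. u x * (\<Sum>y\<in>UNIV. exp (\<bar>\<theta> - \<eta>\<bar> * F) * A \<eta> x y * v \<theta> y))"
    by (intro sum_mono mult_left_mono mult_right_mono A_le_A F) (auto simp: less_imp_le u v_pos)
  also have "\<dots> = exp (\<bar>\<theta> - \<eta>\<bar> * F) * (\<Sum>x\<in>UNIV. u x * (\<Sum>y\<in>UNIV. A \<eta> x y * v \<theta> y))"
    by (simp add: sum_distrib_left mult_ac)
  also have "\<dots> = exp (\<bar>\<theta> - \<eta>\<bar> * F) * rho \<eta> * (\<Sum>x\<in>UNIV. u x * v \<theta> x)"
    by (simp add: u(2))
  finally show ?thesis using Z by simp
qed

lemma rho_tendsto: "(rho \<longlongrightarrow> rho \<eta>) (at \<eta>)"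
proof -
  obtain F where F: "F \<ge> 0" "\<And>x. \<bar>f x\<bar> \<le> F" using f_bound by blast
  have up: "((\<lambda>\<theta>. exp (\<bar>\<theta> - \<eta>\<bar> * F) * rho \<eta>) \<longlongrightarrow> exp (\<bar>\<eta> - \<eta>\<bar> * F) * rho \<eta>) (at \<eta>)"
    by (intro tendsto_intros)
  have lo: "((\<lambda>\<theta>. exp (- \<bar>\<theta> - \<eta>\<bar> * F) * rho \<eta>) \<longlongrightarrow> exp (- \<bar>\<eta> - \<eta>\<bar> * F) * rho \<eta>) (at \<eta>)"
    by (intro tendsto_intros)
  \<comment> \<open>The lower bound is the upper one with the two tilts exchanged.\<close>
  have "exp (- \<bar>\<theta> - \<eta>\<bar> * F) * rho \<eta> \<le> rho \<theta>" for \<theta>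
  proof -
    have "exp (- \<bar>\<theta> - \<eta>\<bar> * F) * rho \<eta> \<le> exp (- \<bar>\<theta> - \<eta>\<bar> * F) * (exp (\<bar>\<eta> - \<theta>\<bar> * F) * rho \<theta>)"
      by (intro mult_left_mono rho_le_rho F) auto
    also have "\<dots> = rho \<theta>" by (simp add: abs_minus_commute exp_minus)
    finally show ?thesis .
  qed
  then show ?thesis
    using lo up rho_le_rho[OF F(2)]
    by (intro tendsto_sandwich[OF _ _ lo[simplified] up[simplified]] always_eventually) (auto simp del: mult_minus_left)
qed

text \<open>Along an edge of P, a single term of the eigenvalue equation already bounds v at the end
  by a multiple of v at the start; irreducibility joins any two states by such edges.\<close>

lemma v_le_v:
  obtains C where "C \<ge> 0" "\<And>\<theta> x y. \<bar>\<theta>\<bar> \<le> T \<Longrightarrow> v \<theta> y \<le> C * v \<theta> x"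
proof -
  obtain F where F: "F \<ge> 0" "\<And>x. \<bar>f x\<bar> \<le> F" using f_bound by blast
  obtain p where p: "p > 0" "\<And>x y. P $ x $ y > 0 \<Longrightarrow> p \<le> P $ x $ y" using P_lower by blast
  \<comment> \<open>One exponential factor compares the matrix entry with P, the other compares
    \<open>rho \<theta>\<close> with \<open>rho 0\<close>.\<close>
  define c where "c = exp (T * F) * rho 0 * exp (T * F) / p"
  have "c \<ge> 0" using p rho_pos[of 0] by (simp add: c_def)
  then obtain C where C: "C \<ge> 0" "\<And>d D x y. D \<ge> 0 \<Longrightarrow> (\<And>x. d x \<ge> 0) \<Longrightarrow>
    (\<And>x y. (x, y) \<in> edges P \<Longrightarrow> d y \<le> c * (d x + D)) \<Longrightarrow> (x, y) \<in> (edges P)\<^sup>* \<Longrightarrow> d y \<le> C * (d x + D)"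
    using rtrancl_affine_bound[of c "edges P"] by metis
  show thesis
  proof
    show "C \<ge> 0" by fact
    fix \<theta> x y assume \<theta>: "\<bar>\<theta>\<bar> \<le> T"
    have TF: "\<bar>\<theta>\<bar> * F \<le> T * F" using \<theta> F by (intro mult_right_mono)
    have "v \<theta> y \<le> c * (v \<theta> x + 0)" if "(x, y) \<in> edges P" for x y
    proof -
      have "P $ x $ y > 0" using that by (simp add: edges_def)
      then have "p \<le> P $ x $ y" by (rule p)
      also have "P $ x $ y = A 0 x y" by (simp add: A_def)
      also have "\<dots> \<le> exp (\<bar>0 - \<theta>\<bar> * F) * A \<theta> x y" by (rule A_le_A[OF F(2)])
      also have "\<dots> \<le> exp (T * F) * A \<theta> x y" using TF by (intro mult_right_mono A_nonneg) simp
      finally have 1: "p \<le> exp (T * F) * A \<theta> x y" .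
      have "A \<theta> x y * v \<theta> y \<le> (\<Sum>y\<in>UNIV. A \<theta> x y * v \<theta> y)"
        by (rule member_le_sum) (auto intro!: mult_nonneg_nonneg A_nonneg less_imp_le[OF v_pos])
      also have "\<dots> = rho \<theta> * v \<theta> x" by (rule v_eigen)
      also have "\<dots> \<le> (exp (\<bar>\<theta> - 0\<bar> * F) * rho 0) * v \<theta> x"
        by (intro mult_right_mono rho_le_rho F less_imp_le[OF v_pos])
      also have "\<dots> \<le> (exp (T * F) * rho 0) * v \<theta> x"
        using TF by (intro mult_right_mono less_imp_le[OF v_pos] less_imp_le[OF rho_pos]) simp
      finally have 2: "A \<theta> x y * v \<theta> y \<le> exp (T * F) * rho 0 * v \<theta> x" .
      have "p * v \<theta> y \<le> exp (T * F) * (A \<theta> x y * v \<theta> y)"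
        using mult_right_mono[OF 1 less_imp_le[OF v_pos[of \<theta> y]]] by (simp add: mult_ac)
      also have "\<dots> \<le> exp (T * F) * (exp (T * F) * rho 0 * v \<theta> x)" using 2 by simp
      finally show ?thesis using p by (simp add: c_def field_simps)
    qed
    then have "v \<theta> y \<le> C * (v \<theta> x + 0)"
      using C(2)[of 0 "v \<theta>" x y] path_P v_pos[of \<theta>] by (simp add: less_imp_le)
    then show "v \<theta> y \<le> C * v \<theta> x" by simp
  qed
qed

text \<open>The derivatives of \<^term>\<open>v\<close> and \<^term>\<open>rho\<close> solve a linear system: as \<^term>\<open>v \<theta> r\<close> is
  constant, column \<^term>\<open>r\<close> of \<open>A - \<rho> I\<close> is free to carry the unknown derivative of \<^term>\<open>rho\<close>.\<close>

definition B :: "real \<Rightarrow> real \<Rightarrow> real^'s^'s" where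
  "B \<eta> \<theta> = (\<chi> i j. if j = r then - v \<theta> i else A \<theta> i j - (if i = j then rho \<eta> else 0))"

lemma B_mult:
  "(B \<eta> \<theta> *v z) $ i = (\<Sum>j\<in>UNIV. A \<theta> i j * (if j = r then 0 else z $ j))
     - rho \<eta> * (if i = r then 0 else z $ i) - z $ r * v \<theta> i"
proof -
  have "B \<eta> \<theta> $ i $ j * z $ j = A \<theta> i j * (if j = r then 0 else z $ j)
      - (if j = i then rho \<eta> * (if i = r then 0 else z $ i) else 0) - (if j = r then z $ r * v \<theta> i else 0)" for j
    by (auto simp: B_def algebra_simps)
  then show ?thesis
    by (simp add: matrix_vector_mult_def sum_subtractf)
qed

text \<open>A kernel vector z yields w with w(r) = 0 and (A - \<rho>) w = z(r) v. Pairing with the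
  left eigenvector forces z(r) = 0; then w is a multiple of v vanishing at \<open>r\<close>, hence
  zero.\<close>

lemma det_B: "det (B \<theta> \<theta>) \<noteq> 0"
proof -
  have "z = 0" if z: "B \<theta> \<theta> *v z = 0" for z
  proof -
    define w where "w j = (if j = r then 0 else z $ j)" for j
    have e: "(\<Sum>j\<in>UNIV. A \<theta> i j * w j) = rho \<theta> * w i + z $ r * v \<theta> i" for i
      using arg_cong[OF z, of "\<lambda>z. z $ i"] by (simp add: B_mult w_def algebra_simps)
    obtain u where u: "\<And>x. u x > 0"
      "\<And>w. (\<Sum>x\<in>UNIV. u x * (\<Sum>y\<in>UNIV. A \<theta> x y * w y)) = rho \<theta> * (\<Sum>x\<in>UNIV. u x * w x)"
      using left_eigenvector[of \<theta>] by blast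
    have "(\<Sum>x\<in>UNIV. u x * v \<theta> x) > 0" by (intro sum_pos_UNIV mult_pos_pos u v_pos)
    moreover have "z $ r * (\<Sum>x\<in>UNIV. u x * v \<theta> x) = 0"
      using u(2)[of w] unfolding e by (simp add: distrib_left sum.distrib sum_distrib_left mult_ac)
    ultimately have zr: "z $ r = 0" by simp
    then have "w x = w r * v \<theta> x" for x using e by (intro eigenspace) simp
    then have "w x = 0" for x by (simp add: w_def)
    then have "z $ x = 0" for x using zr by (metis w_def)
    then show ?thesis by (simp add: vec_eq_iff)
  qed
  then show ?thesis
    by (simp add: invertible_det_nz[symmetric] invertible_left_inverse matrix_left_invertible_ker)
qed

definition incr :: "real \<Rightarrow> real \<Rightarrow> 's \<Rightarrow> real" where
  "incr \<theta> \<eta> k = (if k = r then rho \<eta> - rho \<theta> else v \<eta> k - v \<theta> k)"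

text \<open>The numerator matrix of Cramer's rule: column \<open>k\<close> replaced by the
  right-hand side.\<close>

definition cram :: "real^'s^'s \<Rightarrow> ('s \<Rightarrow> real) \<Rightarrow> 's \<Rightarrow> real^'s^'s" where
  "cram M b k = (\<chi> i j. if j = k then b i else M $ i $ j)"

text \<open>Exact, with no quadratic remainder, because \<open>B \<eta> \<theta>\<close> mixes the
  tilts: \<rho> is taken at \<eta>, while A and v are taken at \<theta>. The product of the two
  increments is thereby absorbed in the matrix.\<close>

lemma B_incr:
  "B \<eta> \<theta> *v (\<chi> k. incr \<theta> \<eta> k) = (\<chi> i. \<Sum>j\<in>UNIV. (A \<theta> i j - A \<eta> i j) * v \<eta> j)"
proof -
  have *: "(if j = r then 0 else (\<chi> k. incr \<theta> \<eta> k) $ j) = v \<eta> j - v \<theta> j" for j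
    by (simp add: incr_def v_root)
  have "(B \<eta> \<theta> *v (\<chi> k. incr \<theta> \<eta> k)) $ i = (\<Sum>j\<in>UNIV. (A \<theta> i j - A \<eta> i j) * v \<eta> j)" for i
    unfolding B_mult *
    by (simp add: right_diff_distrib left_diff_distrib sum_subtractf v_eigen)
       (simp add: incr_def algebra_simps)
  then show ?thesis by (simp add: vec_eq_iff)
qed

lemma incr_div:
  assumes "det (B \<eta> \<theta>) \<noteq> 0"
  shows "incr \<theta> \<eta> k / s = det (cram (B \<eta> \<theta>) (\<lambda>i. (\<Sum>j\<in>UNIV. (A \<theta> i j - A \<eta> i j) / s * v \<eta> j)) k) / det (B \<eta> \<theta>)"
proof -
  have "(\<chi> k. incr \<theta> \<eta> k / s) = (1 / s) *s (\<chi> k. incr \<theta> \<eta> k)"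
    by (simp add: vec_eq_iff)
  then have "B \<eta> \<theta> *v (\<chi> k. incr \<theta> \<eta> k / s) = (1 / s) *s (B \<eta> \<theta> *v (\<chi> k. incr \<theta> \<eta> k))"
    by (simp only: vector_scalar_commute)
  also have "\<dots> = (\<chi> i. \<Sum>j\<in>UNIV. (A \<theta> i j - A \<eta> i j) / s * v \<eta> j)"
    unfolding B_incr by (simp add: vec_eq_iff sum_divide_distrib)
  finally show ?thesis
    unfolding cramer[OF assms] by (simp add: vec_eq_iff cram_def cong: if_cong)
qed

lemma B_tendsto: "((\<lambda>\<eta>. B \<eta> \<theta> $ i $ j) \<longlongrightarrow> B \<theta> \<theta> $ i $ j) (at \<theta>)"
  unfolding B_def by (auto intro!: tendsto_intros rho_tendsto)

text \<open>Used with s = 1 to get continuity of v and with s = \<eta> - \<theta> to get the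
  derivatives; in both cases only the right-hand side of the system has to converge.\<close>

lemma incr_div_tendsto:
  assumes "\<And>i. ((\<lambda>\<eta>. \<Sum>j\<in>UNIV. (A \<theta> i j - A \<eta> i j) / s \<eta> * v \<eta> j) \<longlongrightarrow> b i) (at \<theta>)"
  shows "((\<lambda>\<eta>. incr \<theta> \<eta> k / s \<eta>) \<longlongrightarrow> det (cram (B \<theta> \<theta>) b k) / det (B \<theta> \<theta>)) (at \<theta>)"
proof -
  have d: "((\<lambda>\<eta>. det (B \<eta> \<theta>)) \<longlongrightarrow> det (B \<theta> \<theta>)) (at \<theta>)" by (intro tendsto_det B_tendsto)
  then have "\<forall>\<^sub>F \<eta> in at \<theta>. det (B \<eta> \<theta>) \<noteq> 0" using det_B by (rule tendsto_imp_eventually_ne)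
  then have ev: "\<forall>\<^sub>F \<eta> in at \<theta>.
     det (cram (B \<eta> \<theta>) (\<lambda>i. (\<Sum>j\<in>UNIV. (A \<theta> i j - A \<eta> i j) / s \<eta> * v \<eta> j)) k) / det (B \<eta> \<theta>) = incr \<theta> \<eta> k / s \<eta>"
    by eventually_elim (simp add: incr_div)
  have "((\<lambda>\<eta>. cram (B \<eta> \<theta>) (\<lambda>i. (\<Sum>j\<in>UNIV. (A \<theta> i j - A \<eta> i j) / s \<eta> * v \<eta> j)) k $ i $ j)
     \<longlongrightarrow> cram (B \<theta> \<theta>) b k $ i $ j) (at \<theta>)" for i j
    using assms[of i] B_tendsto[of \<theta> i j] by (cases "j = k") (simp_all add: cram_def)
  then have "((\<lambda>\<eta>. det (cram (B \<eta> \<theta>) (\<lambda>i. (\<Sum>j\<in>UNIV. (A \<theta> i j - A \<eta> i j) / s \<eta> * v \<eta> j)) k) / det (B \<eta> \<theta>))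
     \<longlongrightarrow> det (cram (B \<theta> \<theta>) b k) / det (B \<theta> \<theta>)) (at \<theta>)"
    by (intro tendsto_divide d det_B tendsto_det)
  then show ?thesis using ev by (rule Lim_transform_eventually)
qed

lemma A_deriv: "((\<lambda>\<theta>. A \<theta> x y) has_real_derivative A \<theta> x y * f y) (at \<theta>)"
  unfolding A_def by (auto intro!: derivative_eq_intros)

lemma A_tendsto: "((\<lambda>\<eta>. A \<eta> x y) \<longlongrightarrow> A \<theta> x y) (at \<theta>)"
  using DERIV_isCont[OF A_deriv] by (simp add: isCont_def)

text \<open>The right-hand side is a null sequence (the increment of A) times v at the moving tilt,
  which is bounded near \<theta> by \<open>v_le_v\<close> compared with the base state.\<close>

lemma v_tendsto: "((\<lambda>\<eta>. v \<eta> x) \<longlongrightarrow> v \<theta> x) (at \<theta>)"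
proof (cases "x = r")
  case True
  then show ?thesis by (simp add: v_root)
next
  case False
  obtain C where C: "C \<ge> 0" "\<And>\<eta> x y. \<bar>\<eta>\<bar> \<le> \<bar>\<theta>\<bar> + 1 \<Longrightarrow> v \<eta> y \<le> C * v \<eta> x"
    using v_le_v[of "\<bar>\<theta>\<bar> + 1"] by blast
  have ev: "\<forall>\<^sub>F \<eta> in at \<theta>. \<bar>\<eta>\<bar> \<le> \<bar>\<theta>\<bar> + 1"
    unfolding eventually_at by (rule exI[of _ 1]) (auto simp: dist_real_def)
  have *: "((\<lambda>\<eta>. (A \<theta> i j - A \<eta> i j) / 1 * v \<eta> j) \<longlongrightarrow> 0) (at \<theta>)" for i j
  proof (rule Lim_null_comparison)
    show "\<forall>\<^sub>F \<eta> in at \<theta>. norm ((A \<theta> i j - A \<eta> i j) / 1 * v \<eta> j) \<le> \<bar>A \<theta> i j - A \<eta> i j\<bar> * C"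
      using ev
    proof eventually_elim
      case (elim \<eta>)
      then have "\<bar>v \<eta> j\<bar> \<le> C" using C(2)[of \<eta> j r] v_pos[of \<eta> j] by (simp add: v_root)
      then show ?case by (simp add: abs_mult mult_left_mono)
    qed
    have "((\<lambda>\<eta>. \<bar>A \<theta> i j - A \<eta> i j\<bar> * C) \<longlongrightarrow> \<bar>A \<theta> i j - A \<theta> i j\<bar> * C) (at \<theta>)"
      by (intro tendsto_intros A_tendsto)
    then show "((\<lambda>\<eta>. \<bar>A \<theta> i j - A \<eta> i j\<bar> * C) \<longlongrightarrow> 0) (at \<theta>)" by simp
  qed
  have **: "((\<lambda>\<eta>. incr \<theta> \<eta> x / 1) \<longlongrightarrow> det (cram (B \<theta> \<theta>) (\<lambda>_. 0) x) / det (B \<theta> \<theta>)) (at \<theta>)"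
    by (rule incr_div_tendsto) (rule tendsto_null_sum[OF *])
  \<comment> \<open>Zero right-hand side, so the Cramer numerator has a zero column.\<close>
  have "det (cram (B \<theta> \<theta>) (\<lambda>_. 0) x) = 0"
    by (rule det_zero_column[of x]) (simp add: column_def cram_def vec_eq_iff)
  then have "((\<lambda>\<eta>. v \<eta> x - v \<theta> x) \<longlongrightarrow> 0) (at \<theta>)" using ** False by (simp add: incr_def)
  then show ?thesis by (rule LIM_zero_cancel)
qed

text \<open>Cramer's solution of the limiting system, whose right-hand side is minus the derivative
  of A applied to v.\<close>

definition dsol :: "real \<Rightarrow> 's \<Rightarrow> real" where
  "dsol \<theta> k = det (cram (B \<theta> \<theta>) (\<lambda>i. \<Sum>j\<in>UNIV. - (A \<theta> i j * f j) * v \<theta> j) k) / det (B \<theta> \<theta>)"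

definition drho :: "real \<Rightarrow> real" where "drho \<theta> = dsol \<theta> r"
definition dv :: "real \<Rightarrow> 's \<Rightarrow> real" where "dv \<theta> x = (if x = r then 0 else dsol \<theta> x)"

lemma incr_dsol: "((\<lambda>\<eta>. incr \<theta> \<eta> k / (\<eta> - \<theta>)) \<longlongrightarrow> dsol \<theta> k) (at \<theta>)"
proof -
  have "((\<lambda>\<eta>. (A \<theta> i j - A \<eta> i j) / (\<eta> - \<theta>)) \<longlongrightarrow> - (A \<theta> i j * f j)) (at \<theta>)" for i j
  proof -
    have "((\<lambda>\<eta>. - ((A \<eta> i j - A \<theta> i j) / (\<eta> - \<theta>))) \<longlongrightarrow> - (A \<theta> i j * f j)) (at \<theta>)"
      using A_deriv unfolding has_field_derivative_iff by (rule tendsto_minus)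
    then show ?thesis by (simp only: minus_divide_left minus_diff_eq)
  qed
  then show ?thesis unfolding dsol_def
    by (intro incr_div_tendsto tendsto_sum tendsto_mult v_tendsto)
qed

lemma rho_deriv: "(rho has_real_derivative drho \<theta>) (at \<theta>)"
  using incr_dsol[of \<theta> r] by (simp add: has_field_derivative_iff incr_def drho_def)

lemma v_deriv: "((\<lambda>\<theta>. v \<theta> x) has_real_derivative dv \<theta> x) (at \<theta>)"
proof (cases "x = r")
  case False
  then show ?thesis using incr_dsol[of \<theta> x] by (simp add: has_field_derivative_iff incr_def dv_def)
qed (simp add: v_root dv_def)

text \<open>Bootstrapping: the first derivatives are quotients of determinants in A, v and \<rho>,
  which are differentiable by now. This yields second derivatives with no new limit
  argument.\<close>

lemma dsol_differentiable: "(\<lambda>\<theta>. dsol \<theta> k) differentiable (at \<theta>)"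
proof -
  have A: "(\<lambda>\<theta>. A \<theta> i j) differentiable (at \<theta>)" for i j
    using A_deriv real_differentiable_def by blast
  have v: "(\<lambda>\<theta>. v \<theta> i) differentiable (at \<theta>)" for i
    using v_deriv real_differentiable_def by blast
  have rho: "rho differentiable (at \<theta>)" using rho_deriv real_differentiable_def by blast
  have B: "(\<lambda>\<theta>. B \<theta> \<theta> $ i $ j) differentiable (at \<theta>)" for i j
    by (cases "j = r"; cases "i = j") (auto simp: B_def intro!: differentiable_diff differentiable_minus A v rho)
  have "(\<lambda>\<theta>. cram (B \<theta> \<theta>) (\<lambda>i. \<Sum>j\<in>UNIV. - (A \<theta> i j * f j) * v \<theta> j) k $ i $ j) differentiable (at \<theta>)" for i j
    by (cases "j = k") (auto simp: cram_def intro!: differentiable_sum differentiable_minus differentiable_mult A v B)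
  then show ?thesis
    unfolding dsol_def by (intro differentiable_divide det_differentiable B det_B)
qed

section \<open>Derivatives of the eigenvalue equation and of its logarithmic eigenvalue\<close>

definition ddrho :: "real \<Rightarrow> real" where "ddrho = deriv drho"
definition ddv :: "real \<Rightarrow> 's \<Rightarrow> real" where "ddv \<theta> x = deriv (\<lambda>t. dv t x) \<theta>"

lemma drho_deriv: "(drho has_real_derivative ddrho \<theta>) (at \<theta>)"
  unfolding drho_def[abs_def] ddrho_def
  using dsol_differentiable[of r \<theta>] by (auto simp: real_differentiable_def dest: DERIV_imp_deriv)

lemma dv_deriv: "((\<lambda>\<theta>. dv \<theta> x) has_real_derivative ddv \<theta> x) (at \<theta>)"
proof (cases "x = r")
  case True
  then show ?thesis by (simp add: dv_def ddv_def)
next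
  case False
  then show ?thesis using dsol_differentiable[of x \<theta>]
    by (auto simp: real_differentiable_def dv_def ddv_def dest: DERIV_imp_deriv)
qed

lemma first_order:
  "(\<Sum>y\<in>UNIV. A \<theta> x y * (f y * v \<theta> y + dv \<theta> y)) = drho \<theta> * v \<theta> x + rho \<theta> * dv \<theta> x"
proof (rule DERIV_unique)
  show "((\<lambda>\<theta>. rho \<theta> * v \<theta> x) has_real_derivative drho \<theta> * v \<theta> x + rho \<theta> * dv \<theta> x) (at \<theta>)"
    by (auto intro!: derivative_eq_intros rho_deriv v_deriv)
  show "((\<lambda>\<theta>. rho \<theta> * v \<theta> x) has_real_derivative (\<Sum>y\<in>UNIV. A \<theta> x y * (f y * v \<theta> y + dv \<theta> y))) (at \<theta>)"
    unfolding v_eigen[symmetric]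
    by (auto intro!: derivative_eq_intros A_deriv v_deriv sum.cong simp: algebra_simps)
qed

lemma second_order:
  "(\<Sum>y\<in>UNIV. A \<theta> x y * ((f y)\<^sup>2 * v \<theta> y + 2 * f y * dv \<theta> y + ddv \<theta> y))
    = ddrho \<theta> * v \<theta> x + 2 * drho \<theta> * dv \<theta> x + rho \<theta> * ddv \<theta> x"
proof (rule DERIV_unique)
  show "((\<lambda>\<theta>. drho \<theta> * v \<theta> x + rho \<theta> * dv \<theta> x) has_real_derivative
      ddrho \<theta> * v \<theta> x + 2 * drho \<theta> * dv \<theta> x + rho \<theta> * ddv \<theta> x) (at \<theta>)"
    by (auto intro!: derivative_eq_intros rho_deriv v_deriv drho_deriv dv_deriv)
  show "((\<lambda>\<theta>. drho \<theta> * v \<theta> x + rho \<theta> * dv \<theta> x) has_real_derivative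
      (\<Sum>y\<in>UNIV. A \<theta> x y * ((f y)\<^sup>2 * v \<theta> y + 2 * f y * dv \<theta> y + ddv \<theta> y))) (at \<theta>)"
    unfolding first_order[symmetric]
    by (auto intro!: derivative_eq_intros A_deriv v_deriv dv_deriv sum.cong simp: algebra_simps power2_eq_square)
qed

lemma Lambda_eq: "Lambda P f = (\<lambda>\<theta>. ln (rho \<theta>))"
  by (simp add: Lambda_def rho_def fun_eq_iff)

lemma Lambda_deriv: "(Lambda P f has_real_derivative drho \<theta> / rho \<theta>) (at \<theta>)"
  unfolding Lambda_eq using rho_pos[of \<theta>] by (auto intro!: derivative_eq_intros rho_deriv)

lemma deriv_Lambda: "deriv (Lambda P f) = (\<lambda>\<theta>. drho \<theta> / rho \<theta>)"
  using Lambda_deriv by (intro ext DERIV_imp_deriv)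

lemma dLambda_deriv:
  "((\<lambda>\<theta>. drho \<theta> / rho \<theta>) has_real_derivative ddrho \<theta> / rho \<theta> - (drho \<theta> / rho \<theta>)\<^sup>2) (at \<theta>)"
  using rho_pos[of \<theta>]
  by (auto intro!: derivative_eq_intros rho_deriv drho_deriv simp: field_simps power2_eq_square)

lemma deriv2_Lambda: "deriv (deriv (Lambda P f)) \<theta> = ddrho \<theta> / rho \<theta> - (drho \<theta> / rho \<theta>)\<^sup>2"
  unfolding deriv_Lambda using dLambda_deriv by (rule DERIV_imp_deriv)

end

subsection \<open>The second derivative as an averaged conditional variance\<close>

text \<open>Averages the inequality (M - h)(h - m) >= 0, where M and m are the extreme values of
  h.\<close>

lemma popoviciu:
  fixes q h :: "'s::finite \<Rightarrow> real"
  assumes q: "\<And>x. q x \<ge> 0" "(\<Sum>x\<in>UNIV. q x) = 1" and h: "\<And>x y. h x - h y \<le> D"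
  shows "(\<Sum>x\<in>UNIV. q x * (h x)\<^sup>2) \<le> (\<Sum>x\<in>UNIV. q x * h x)\<^sup>2 + D\<^sup>2 / 4"
proof -
  define M where "M = Max (range h)"
  define m where "m = Min (range h)"
  define \<mu> where "\<mu> = (\<Sum>x\<in>UNIV. q x * h x)"
  have M: "h x \<le> M" and m: "m \<le> h x" for x by (auto simp: M_def m_def)
  have "M \<in> range h" "m \<in> range h" unfolding M_def m_def by (auto intro!: Max_in Min_in)
  then have "M - m \<le> D" using h by auto
  then have D: "(M - m)\<^sup>2 \<le> D\<^sup>2" using M[of undefined] m[of undefined] by (intro power_mono) linarith+
  have "0 \<le> (\<Sum>x\<in>UNIV. q x * ((M - h x) * (h x - m)))"
    using q M m by (intro sum_nonneg mult_nonneg_nonneg) auto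
  also have "\<dots> = (\<Sum>x\<in>UNIV. (M + m) * (q x * h x) - M * m * q x - q x * (h x)\<^sup>2)"
    by (intro sum.cong refl) (simp add: algebra_simps power2_eq_square)
  also have "\<dots> = (M + m) * \<mu> - M * m - (\<Sum>x\<in>UNIV. q x * (h x)\<^sup>2)"
    by (simp add: sum_subtractf sum_distrib_left[symmetric] \<mu>_def q)
  finally have "(\<Sum>x\<in>UNIV. q x * (h x)\<^sup>2) \<le> (M + m) * \<mu> - M * m" by simp
  \<comment> \<open>Completing the square in \<mu>.\<close>
  also have "\<dots> = \<mu>\<^sup>2 + (M - m)\<^sup>2 / 4 - (\<mu> - (M + m) / 2)\<^sup>2"
    by (simp add: power2_eq_square field_simps)
  also have "\<dots> \<le> \<mu>\<^sup>2 + D\<^sup>2 / 4" using D zero_le_power2[of "\<mu> - (M + m) / 2"] by linarith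
  finally show ?thesis by (simp add: \<mu>_def)
qed

context tilted_chain begin

definition w :: "real \<Rightarrow> 's \<Rightarrow> real" where "w \<theta> x = dv \<theta> x / v \<theta> x"
text \<open>The Doob transform of the tilted matrix by its Perron vector.\<close>

definition Q :: "real \<Rightarrow> 's \<Rightarrow> 's \<Rightarrow> real" where "Q \<theta> x y = A \<theta> x y * v \<theta> y / (rho \<theta> * v \<theta> x)"

lemma dv_eq: "dv \<theta> x = w \<theta> x * v \<theta> x" by (simp add: w_def)

lemma Q_nonneg: "Q \<theta> x y \<ge> 0"
  unfolding Q_def
  by (intro divide_nonneg_nonneg mult_nonneg_nonneg A_nonneg less_imp_le[OF v_pos] less_imp_le[OF rho_pos])

lemma Q_row: "(\<Sum>y\<in>UNIV. Q \<theta> x y) = 1"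
  unfolding Q_def sum_divide_distrib[symmetric] v_eigen using rho_pos[of \<theta>] by simp

lemma sum_Q: "(\<Sum>y\<in>UNIV. A \<theta> x y * (v \<theta> y * g y)) = rho \<theta> * v \<theta> x * (\<Sum>y\<in>UNIV. Q \<theta> x y * g y)"
  unfolding Q_def sum_distrib_left using rho_pos[of \<theta>] by (intro sum.cong) auto

lemma poisson: "(\<Sum>y\<in>UNIV. Q \<theta> x y * (f y + w \<theta> y)) = drho \<theta> / rho \<theta> + w \<theta> x"
proof -
  have "rho \<theta> * v \<theta> x * (\<Sum>y\<in>UNIV. Q \<theta> x y * (f y + w \<theta> y)) = drho \<theta> * v \<theta> x + rho \<theta> * dv \<theta> x"
    unfolding sum_Q[symmetric] first_order[symmetric]
    by (intro sum.cong refl) (simp add: dv_eq distrib_left mult.commute)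
  also have "\<dots> = rho \<theta> * v \<theta> x * (drho \<theta> / rho \<theta> + w \<theta> x)"
    using rho_pos[of \<theta>] by (simp add: dv_eq distrib_left)
  finally show ?thesis using rho_pos[of \<theta>] by simp
qed

text \<open>The u-weighted sum of A v h^2, with h = f + w, is estimated above row by row by
  Popoviciu's inequality and computed exactly from \<open>second_order\<close>. The terms with w and
  w^2 agree on both sides, leaving an inequality for \<open>ddrho\<close>.\<close>

lemma Lambda2_le:
  assumes osc: "\<And>x y. (f x + w \<theta> x) - (f y + w \<theta> y) \<le> D"
  shows "deriv (deriv (Lambda P f)) \<theta> \<le> D\<^sup>2 / 4"
proof -
  obtain u where u: "\<And>x. u x > 0"
    "\<And>w. (\<Sum>x\<in>UNIV. u x * (\<Sum>y\<in>UNIV. A \<theta> x y * w y)) = rho \<theta> * (\<Sum>x\<in>UNIV. u x * w x)"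
    using left_eigenvector[of \<theta>] by blast
  let ?Z = "\<Sum>x\<in>UNIV. u x * v \<theta> x" and ?l = "drho \<theta> / rho \<theta>"
  let ?h = "\<lambda>x. f x + w \<theta> x"
  let ?W = "\<Sum>x\<in>UNIV. u x * (v \<theta> x * w \<theta> x)" and ?W2 = "\<Sum>x\<in>UNIV. u x * (v \<theta> x * (w \<theta> x)\<^sup>2)"
  have Z: "?Z > 0" by (intro sum_pos_UNIV mult_pos_pos u v_pos)
  have rho: "rho \<theta> > 0" by (rule rho_pos)
  have "(\<Sum>x\<in>UNIV. u x * (\<Sum>y\<in>UNIV. A \<theta> x y * (v \<theta> y * (?h y)\<^sup>2)))
     \<le> (\<Sum>x\<in>UNIV. u x * (rho \<theta> * v \<theta> x * ((?l + w \<theta> x)\<^sup>2 + D\<^sup>2 / 4)))"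
  proof (intro sum_mono mult_left_mono)
    fix x
    have "(\<Sum>y\<in>UNIV. Q \<theta> x y * (?h y)\<^sup>2) \<le> (?l + w \<theta> x)\<^sup>2 + D\<^sup>2 / 4"
      unfolding poisson[symmetric] by (rule popoviciu[OF Q_nonneg Q_row osc])
    then show "(\<Sum>y\<in>UNIV. A \<theta> x y * (v \<theta> y * (?h y)\<^sup>2)) \<le> rho \<theta> * v \<theta> x * ((?l + w \<theta> x)\<^sup>2 + D\<^sup>2 / 4)"
      unfolding sum_Q using rho v_pos[of \<theta> x] by simp
    show "0 \<le> u x" using u(1)[of x] by simp
  qed
  also have "\<dots> = (\<Sum>x\<in>UNIV. (rho \<theta> * (?l\<^sup>2 + D\<^sup>2 / 4)) * (u x * v \<theta> x)
      + 2 * drho \<theta> * (u x * (v \<theta> x * w \<theta> x)) + rho \<theta> * (u x * (v \<theta> x * (w \<theta> x)\<^sup>2)))"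
    using rho by (intro sum.cong refl) (simp add: field_simps power2_eq_square)
  also have "\<dots> = rho \<theta> * (?l\<^sup>2 + D\<^sup>2 / 4) * ?Z + 2 * drho \<theta> * ?W + rho \<theta> * ?W2"
    by (simp only: sum.distrib sum_distrib_left)
  finally have upper: "(\<Sum>x\<in>UNIV. u x * (\<Sum>y\<in>UNIV. A \<theta> x y * (v \<theta> y * (?h y)\<^sup>2)))
     \<le> rho \<theta> * (?l\<^sup>2 + D\<^sup>2 / 4) * ?Z + 2 * drho \<theta> * ?W + rho \<theta> * ?W2" .
  \<comment> \<open>Expanding the square gives the left side of \<open>second_order\<close>, except
    that v w^2 stands in place of \<open>ddv\<close>.\<close>
  have h2: "(\<Sum>y\<in>UNIV. A \<theta> x y * (v \<theta> y * (?h y)\<^sup>2))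
      = ddrho \<theta> * v \<theta> x + 2 * drho \<theta> * (v \<theta> x * w \<theta> x) + rho \<theta> * ddv \<theta> x
        + (\<Sum>y\<in>UNIV. A \<theta> x y * (v \<theta> y * (w \<theta> y)\<^sup>2)) - (\<Sum>y\<in>UNIV. A \<theta> x y * ddv \<theta> y)" for x
    using second_order[of \<theta> x]
    by (simp add: dv_eq power2_eq_square algebra_simps sum.distrib)
  have "(\<Sum>x\<in>UNIV. u x * (\<Sum>y\<in>UNIV. A \<theta> x y * (v \<theta> y * (?h y)\<^sup>2)))
     = (\<Sum>x\<in>UNIV. ddrho \<theta> * (u x * v \<theta> x) + 2 * drho \<theta> * (u x * (v \<theta> x * w \<theta> x)) + rho \<theta> * (u x * ddv \<theta> x)
        + u x * (\<Sum>y\<in>UNIV. A \<theta> x y * (v \<theta> y * (w \<theta> y)\<^sup>2)) - u x * (\<Sum>y\<in>UNIV. A \<theta> x y * ddv \<theta> y))"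
    unfolding h2 by (intro sum.cong refl) (simp add: distrib_left right_diff_distrib mult_ac)
  \<comment> \<open>The unknown \<open>ddv\<close> cancels, since u is a left eigenvector.\<close>
  also have "\<dots> = ddrho \<theta> * ?Z + 2 * drho \<theta> * ?W + rho \<theta> * ?W2"
    by (simp add: sum.distrib sum_subtractf u(2) sum_distrib_left[symmetric])
  finally have "ddrho \<theta> * ?Z \<le> rho \<theta> * (?l\<^sup>2 + D\<^sup>2 / 4) * ?Z" using upper by simp
  then have "ddrho \<theta> \<le> rho \<theta> * (?l\<^sup>2 + D\<^sup>2 / 4)" using Z by simp
  then have "ddrho \<theta> / rho \<theta> \<le> ?l\<^sup>2 + D\<^sup>2 / 4" using rho by (simp add: pos_divide_le_eq mult.commute)
  then show ?thesis unfolding deriv2_Lambda by linarith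
qed

lemma perron_ratio_deriv: "deriv (perron_ratio P f x y) \<theta> = v \<theta> x / v \<theta> y * (w \<theta> x - w \<theta> y)"
proof (rule DERIV_imp_deriv)
  show "(perron_ratio P f x y has_real_derivative v \<theta> x / v \<theta> y * (w \<theta> x - w \<theta> y)) (at \<theta>)"
    unfolding perron_ratio_eq[abs_def] w_def
    by (auto intro!: derivative_eq_intros v_deriv simp: field_simps)
qed

section \<open>Values at zero tilt\<close>

lemma rho_zero: "rho 0 = 1" and v_zero: "v 0 x = 1"
proof -
  have e: "tilted P f 0 *v (\<chi> x. 1) = 1 *s (\<chi> x. 1)"
    by (simp add: vec_eq_iff matrix_vector_mult_def A_def P_row)
  show rho: "rho 0 = 1" unfolding rho_def by (rule spectral_radius_eqI[OF irred_tilted _ e]) simp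
  have "(\<Sum>y\<in>UNIV. A 0 x y * 1) = rho 0 * 1" for x using rho by (simp add: A_def P_row)
  from eigenspace[of 0 "\<lambda>_. 1", OF this] show "v 0 x = 1" by simp
qed

text \<open>At zero tilt \<pi> is a left eigenvector of P, so pairing \<open>first_order\<close>
  with it cancels the derivative of v and leaves the mean of f.\<close>

lemma drho_zero:
  assumes "stationary P \<pi>"
  shows "drho 0 = mean \<pi> f"
proof -
  have s: "(\<Sum>x\<in>UNIV. \<pi> $ x) = 1" "\<pi> v* P = 1 *s \<pi>" using assms by (auto simp: stationary_def)
  have "(\<Sum>x\<in>UNIV. \<pi> $ x * (\<Sum>y\<in>UNIV. P $ x $ y * (f y + dv 0 y))) = (\<Sum>x\<in>UNIV. \<pi> $ x * (drho 0 + dv 0 x))"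
    using first_order[of 0] by (simp add: rho_zero v_zero A_def)
  moreover have "(\<Sum>x\<in>UNIV. \<pi> $ x * drho 0) = drho 0" by (simp add: s(1) flip: sum_distrib_right)
  ultimately show ?thesis
    unfolding left_right_product[OF s(2)] mean_def
    by (simp add: distrib_left sum.distrib mult.commute[of "f _"])
qed

end

subsection \<open>Bounds that are uniform in the tilt\<close>

text \<open>The half of the problem with \<theta> >= 0, where the maximal set of f governs.
  Interpreting it with -f, -b, -a makes S_a the maximal set and covers the other half.\<close>

locale extremal_chain = tilted_chain P f r
  for P :: "real^'s::finite^'s" and f :: "'s \<Rightarrow> real" and r :: 's +
  fixes a b :: real
  assumes a_le: "a \<le> f x" and le_b: "f x \<le> b" and b_attained: "\<exists>x. f x = b"
    and irr_b: "irreducible_on {x. f x = b} P"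
    and enter_b: "f x \<noteq> b \<Longrightarrow> \<exists>y. f y = b \<and> P $ x $ y > 0"
begin

text \<open>Edges into the maximal set: their tilted weights divided by exp(\<theta> b) are the
  entries of P, independent of \<theta>.\<close>

definition E :: "'s rel" where "E = {(x, y). P $ x $ y > 0 \<and> f y = b}"

lemma path_E:
  assumes "f y = b"
  shows "(x, y) \<in> E\<^sup>*"
proof -
  have T: "(z, y) \<in> E\<^sup>*" if "f z = b" for z
  proof -
    have "(z, y) \<in> (edges P \<inter> {x. f x = b} \<times> {x. f x = b})\<^sup>+"
      using irreducible_on_path[OF irr_b] assms that by simp
    moreover have "edges P \<inter> {x. f x = b} \<times> {x. f x = b} \<subseteq> E" by (auto simp: edges_def E_def)
    ultimately show ?thesis by (metis trancl_into_rtrancl trancl_mono)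
  qed
  show ?thesis
  proof (cases "f x = b")
    case False
    then obtain z where "f z = b" "P $ x $ z > 0" using enter_b by blast
    then have "(x, z) \<in> E" "(z, y) \<in> E\<^sup>*" using T by (auto simp: E_def)
    then show ?thesis by (rule converse_rtrancl_into_rtrancl)
  qed (rule T)
qed

text \<open>Read the eigenvalue equation at a state where v is maximal.\<close>

lemma rho_le:
  assumes "\<theta> \<ge> 0"
  shows "rho \<theta> \<le> exp (\<theta> * b)"
proof -
  have "Max (range (v \<theta>)) \<in> range (v \<theta>)" by (rule Max_in) auto
  then obtain x where "Max (range (v \<theta>)) = v \<theta> x" by blast
  then have x: "v \<theta> y \<le> v \<theta> x" for y by (metis Max_ge finite UNIV_I finite_imageI image_eqI)
  have "rho \<theta> * v \<theta> x = (\<Sum>y\<in>UNIV. P $ x $ y * exp (\<theta> * f y) * v \<theta> y)"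
    using v_eigen[of \<theta> x] by (simp add: A_def)
  also have "\<dots> \<le> (\<Sum>y\<in>UNIV. P $ x $ y * exp (\<theta> * b) * v \<theta> x)"
    using x assms le_b P_nonneg v_pos[of \<theta>]
    by (intro sum_mono mult_mono mult_left_mono) (auto intro: mult_left_mono simp: less_imp_le)
  also have "\<dots> = exp (\<theta> * b) * v \<theta> x" by (simp add: P_row flip: sum_distrib_right)
  finally show ?thesis using v_pos[of \<theta> x] by simp
qed

lemma step_b:
  assumes "\<theta> \<ge> 0" "f y = b"
  shows "exp (\<theta> * b) * P $ x $ y * v \<theta> y \<le> rho \<theta> * v \<theta> x"
proof -
  have "A \<theta> x y * v \<theta> y \<le> (\<Sum>y\<in>UNIV. A \<theta> x y * v \<theta> y)"
    by (rule member_le_sum) (auto intro!: mult_nonneg_nonneg A_nonneg less_imp_le[OF v_pos])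
  then show ?thesis using assms(2) unfolding v_eigen by (simp add: A_def mult_ac)
qed

text \<open>Along an edge of \<open>E\<close> the factor exp(\<theta> b) from \<open>step_b\<close>
  cancels against the one in \<open>rho_le\<close>, leaving the step constant 1/p for all \<theta>
  >= 0.\<close>

lemma v_b_le:
  obtains C where "C > 0" "\<And>\<theta> x y. \<theta> \<ge> 0 \<Longrightarrow> f y = b \<Longrightarrow> v \<theta> y \<le> C * v \<theta> x"
proof -
  obtain p where p: "p > 0" "\<And>x y. P $ x $ y > 0 \<Longrightarrow> p \<le> P $ x $ y" using P_lower by blast
  obtain C where C: "C \<ge> 0" "\<And>d D x y. D \<ge> 0 \<Longrightarrow> (\<And>x. d x \<ge> 0) \<Longrightarrow>
    (\<And>x y. (x, y) \<in> E \<Longrightarrow> d y \<le> 1 / p * (d x + D)) \<Longrightarrow> (x, y) \<in> E\<^sup>* \<Longrightarrow> d y \<le> C * (d x + D)"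
    using rtrancl_affine_bound[of "1 / p" E] p by (metis divide_nonneg_pos zero_le_one)
  have le: "v \<theta> y \<le> C * v \<theta> x" if \<theta>: "\<theta> \<ge> 0" and y: "f y = b" for \<theta> x y
  proof -
    have "v \<theta> y \<le> 1 / p * (v \<theta> x + 0)" if "(x, y) \<in> E" for x y
    proof -
      have xy: "P $ x $ y > 0" "f y = b" using that by (auto simp: E_def)
      have "exp (\<theta> * b) * (p * v \<theta> y) \<le> exp (\<theta> * b) * P $ x $ y * v \<theta> y"
        using p(2)[OF xy(1)] v_pos[of \<theta> y] by simp
      also have "\<dots> \<le> rho \<theta> * v \<theta> x" by (rule step_b[OF \<theta> xy(2)])
      also have "\<dots> \<le> exp (\<theta> * b) * v \<theta> x" using rho_le[OF \<theta>] v_pos[of \<theta> x] by simp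
      finally show ?thesis using p by (simp add: field_simps)
    qed
    then show ?thesis using C(2)[of 0 "v \<theta>" x y] path_E[OF y] v_pos[of \<theta>] by (simp add: less_imp_le)
  qed
  \<comment> \<open>Comparing a state with itself at zero tilt, where v = 1, forces C >= 1.\<close>
  obtain y where "f y = b" using b_attained by blast
  then have "v 0 y \<le> C * v 0 y" by (intro le) auto
  then have "C > 0" using v_zero by simp
  then show thesis using le that by blast
qed

text \<open>Irreducibility on the maximal set provides an edge inside it, even when it is a single
  state. One term of the eigenvalue equation along this edge, together with \<open>v_b_le\<close>
  backwards, gives the bound.\<close>

lemma rho_ge:
  obtains \<rho> where "\<rho> > 0" "\<And>\<theta>. \<theta> \<ge> 0 \<Longrightarrow> \<rho> * exp (\<theta> * b) \<le> rho \<theta>"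
proof -
  obtain C where C: "C > 0" "\<And>\<theta> x y. \<theta> \<ge> 0 \<Longrightarrow> f y = b \<Longrightarrow> v \<theta> y \<le> C * v \<theta> x"
    using v_b_le by blast
  obtain x where x: "f x = b" using b_attained by blast
  have "(x, x) \<in> (edges P \<inter> {x. f x = b} \<times> {x. f x = b})\<^sup>+"
    using irreducible_on_path[OF irr_b] x by simp
  then obtain y where y: "P $ x $ y > 0" "f y = b" by (auto dest!: tranclD simp: edges_def)
  show thesis
  proof
    show "P $ x $ y / C > 0" using y C by simp
    fix \<theta> :: real assume \<theta>: "\<theta> \<ge> 0"
    have "exp (\<theta> * b) * P $ x $ y * v \<theta> y \<le> rho \<theta> * v \<theta> x" by (rule step_b[OF \<theta> y(2)])
    also have "\<dots> \<le> rho \<theta> * (C * v \<theta> y)" using C(2)[OF \<theta> x] rho_pos[of \<theta>] by simp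
    finally have "exp (\<theta> * b) * P $ x $ y \<le> rho \<theta> * C" using v_pos[of \<theta> y] by simp
    then show "P $ x $ y / C * exp (\<theta> * b) \<le> rho \<theta>" using C by (simp add: field_simps)
  qed
qed

lemma gap:
  obtains \<delta> where "\<delta> > 0" "\<And>y. f y \<noteq> b \<Longrightarrow> f y \<le> b - \<delta>"
proof
  let ?S = "insert 1 ((\<lambda>y. b - f y) ` {y. f y \<noteq> b})"
  show "Min ?S > 0" using le_b by (subst Min_gr_iff) (auto simp: less_le)
  show "f y \<le> b - Min ?S" if "f y \<noteq> b" for y
  proof -
    have "Min ?S \<le> b - f y" using that by (intro Min_le) auto
    then show ?thesis by simp
  qed
qed

text \<open>For large \<open>\<theta>\<close> the entries outside the columns of maximal \<^term>\<open>f\<close> contribute at most half of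
  the eigenvalue, so the maximum of \<^term>\<open>v \<theta>\<close> is controlled by its values on the maximal set.\<close>

lemma v_ratio_bounded:
  obtains K where "K > 0" "\<And>\<theta> x y. \<theta> \<ge> 0 \<Longrightarrow> v \<theta> y \<le> K * v \<theta> x"
proof -
  obtain C where C: "C > 0" "\<And>\<theta> x y. \<theta> \<ge> 0 \<Longrightarrow> f y = b \<Longrightarrow> v \<theta> y \<le> C * v \<theta> x"
    using v_b_le by blast
  obtain \<rho> where \<rho>: "\<rho> > 0" "\<And>\<theta>. \<theta> \<ge> 0 \<Longrightarrow> \<rho> * exp (\<theta> * b) \<le> rho \<theta>" using rho_ge by blast
  obtain \<delta> where \<delta>: "\<delta> > 0" "\<And>y. f y \<noteq> b \<Longrightarrow> f y \<le> b - \<delta>" using gap by blast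
  \<comment> \<open>From this tilt on, exp(-\<theta> \<delta>) <= \<rho>/2, where \<delta> is the
    gap below b.\<close>
  define T where "T = max 0 (ln (2 / \<rho>) / \<delta>)"
  obtain C' where C': "C' \<ge> 0" "\<And>\<theta> x y. \<bar>\<theta>\<bar> \<le> T \<Longrightarrow> v \<theta> y \<le> C' * v \<theta> x"
    using v_le_v[of T] by blast
  \<comment> \<open>\<open>C'\<close> covers tilts up to \<open>T\<close>; beyond it, absorbing
    \<rho>/2 times the maximum of v into the left side leaves the factor 2C/\<rho>.\<close>
  define K where "K = max C' (2 * C / \<rho>)"
  show thesis
  proof
    show "K > 0" using C \<rho> by (auto simp: K_def less_max_iff_disj)
    fix \<theta> x y assume \<theta>: "\<theta> \<ge> (0::real)"
    show "v \<theta> y \<le> K * v \<theta> x"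
    proof (cases "\<theta> \<le> T")
      case True
      then have "v \<theta> y \<le> C' * v \<theta> x" using \<theta> by (intro C') auto
      also have "\<dots> \<le> K * v \<theta> x" using v_pos[of \<theta> x] by (simp add: K_def)
      finally show ?thesis .
    next
      case False
      then have "ln (2 / \<rho>) / \<delta> \<le> \<theta>" by (simp add: T_def)
      then have "ln (2 / \<rho>) \<le> \<theta> * \<delta>" using \<delta>(1) by (simp add: pos_divide_le_eq)
      then have "exp (- (\<theta> * \<delta>)) \<le> exp (- ln (2 / \<rho>))" by simp
      then have small: "exp (- (\<theta> * \<delta>)) \<le> \<rho> / 2" using \<rho>(1) by (simp add: exp_minus)
      have "Max (range (v \<theta>)) \<in> range (v \<theta>)" by (rule Max_in) auto
      then obtain m where "Max (range (v \<theta>)) = v \<theta> m" by blast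
      then have m: "v \<theta> y \<le> v \<theta> m" for y by (metis Max_ge finite UNIV_I finite_imageI image_eqI)
      have "\<rho> * exp (\<theta> * b) * v \<theta> m \<le> rho \<theta> * v \<theta> m"
        using \<rho>(2)[OF \<theta>] v_pos[of \<theta> m] by simp
      also have "\<dots> = (\<Sum>y\<in>UNIV. A \<theta> m y * v \<theta> y)" by (simp add: v_eigen)
      also have "\<dots> \<le> (\<Sum>y\<in>UNIV. P $ m $ y * (exp (\<theta> * b) * (C * v \<theta> x + \<rho> / 2 * v \<theta> m)))"
      proof (intro sum_mono)
        fix y
        have "exp (\<theta> * f y) * v \<theta> y \<le> exp (\<theta> * b) * (C * v \<theta> x + \<rho> / 2 * v \<theta> m)"
        proof (cases "f y = b")
          case True
          have "v \<theta> y \<le> C * v \<theta> x + \<rho> / 2 * v \<theta> m"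
            using C(2)[OF \<theta> True, of x] mult_pos_pos[OF half_gt_zero[OF \<rho>(1)] v_pos[of \<theta> m]] by linarith
          then show ?thesis using True by simp
        next
          case False
          have "\<theta> * f y \<le> \<theta> * (b - \<delta>)" using \<delta>(2)[OF False] \<theta> by (rule mult_left_mono)
          then have "exp (\<theta> * f y) \<le> exp (\<theta> * b) * exp (- (\<theta> * \<delta>))"
            unfolding exp_add[symmetric] by (simp add: algebra_simps)
          also have "\<dots> \<le> exp (\<theta> * b) * (\<rho> / 2)" using small by simp
          finally have "exp (\<theta> * f y) * v \<theta> y \<le> exp (\<theta> * b) * (\<rho> / 2) * v \<theta> m"
            using m[of y] v_pos[of \<theta> y] \<rho>(1) by (intro mult_mono) auto
          also have "\<dots> \<le> exp (\<theta> * b) * (C * v \<theta> x + \<rho> / 2 * v \<theta> m)"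
            using mult_pos_pos[OF C(1) v_pos[of \<theta> x]] by (simp add: distrib_left)
          finally show ?thesis .
        qed
        then show "A \<theta> m y * v \<theta> y \<le> P $ m $ y * (exp (\<theta> * b) * (C * v \<theta> x + \<rho> / 2 * v \<theta> m))"
          unfolding A_def mult.assoc by (rule mult_left_mono[OF _ P_nonneg])
      qed
      also have "\<dots> = exp (\<theta> * b) * (C * v \<theta> x + \<rho> / 2 * v \<theta> m)"
        by (simp add: P_row flip: sum_distrib_right)
      finally have "exp (\<theta> * b) * (\<rho> * v \<theta> m) \<le> exp (\<theta> * b) * (C * v \<theta> x + \<rho> / 2 * v \<theta> m)"
        by (simp only: mult_ac)
      then have "\<rho> * v \<theta> m \<le> C * v \<theta> x + \<rho> / 2 * v \<theta> m" by simp
      then have "v \<theta> m \<le> 2 * C / \<rho> * v \<theta> x" using \<rho>(1) by (simp add: field_simps)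
      also have "\<dots> \<le> K * v \<theta> x"
        unfolding K_def by (intro mult_right_mono max.cobounded2 less_imp_le[OF v_pos])
      finally show ?thesis using m[of y] by linarith
    qed
  qed
qed

lemma ab: "a \<le> b" using a_le le_b order_trans by blast

lemma sum_Q_f: "a \<le> (\<Sum>y\<in>UNIV. Q \<theta> x y * f y)" "(\<Sum>y\<in>UNIV. Q \<theta> x y * f y) \<le> b"
proof -
  have "(\<Sum>y\<in>UNIV. Q \<theta> x y * a) \<le> (\<Sum>y\<in>UNIV. Q \<theta> x y * f y)"
    by (intro sum_mono mult_left_mono a_le Q_nonneg)
  then show "a \<le> (\<Sum>y\<in>UNIV. Q \<theta> x y * f y)" by (simp add: Q_row flip: sum_distrib_right)
  have "(\<Sum>y\<in>UNIV. Q \<theta> x y * f y) \<le> (\<Sum>y\<in>UNIV. Q \<theta> x y * b)"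
    by (intro sum_mono mult_left_mono le_b Q_nonneg)
  then show "(\<Sum>y\<in>UNIV. Q \<theta> x y * f y) \<le> b" by (simp add: Q_row flip: sum_distrib_right)
qed

text \<open>By the Poisson equation, averaging the distance of w from its maximum under a row of Q
  changes it by at most b - a. As Q is bounded below on \<open>E\<close>, this distance grows in a
  controlled way from 0 at a maximiser to a state of the maximal set. The minimum is treated alike,
  and both paths end at the same state \<open>y0\<close>.\<close>

lemma w_osc_bounded:
  obtains L where "L \<ge> 0" "\<And>\<theta> x y. \<theta> \<ge> 0 \<Longrightarrow> \<bar>w \<theta> x - w \<theta> y\<bar> \<le> L"
proof -
  obtain K where K: "K > 0" "\<And>\<theta> x y. \<theta> \<ge> 0 \<Longrightarrow> v \<theta> y \<le> K * v \<theta> x" using v_ratio_bounded by blast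
  obtain p where p: "p > 0" "\<And>x y. P $ x $ y > 0 \<Longrightarrow> p \<le> P $ x $ y" using P_lower by blast
  \<comment> \<open>Its inverse is a lower bound for Q on \<open>E\<close>: the entry of P is at
    least p, the ratio of v at least 1/K, and \<rho> at most exp(\<theta> b).\<close>
  define c where "c = K / p"
  have c: "c > 0" using K p by (simp add: c_def)
  obtain C where C: "C \<ge> 0" "\<And>d D x y. D \<ge> 0 \<Longrightarrow> (\<And>x. d x \<ge> 0) \<Longrightarrow>
    (\<And>x y. (x, y) \<in> E \<Longrightarrow> d y \<le> c * (d x + D)) \<Longrightarrow> (x, y) \<in> E\<^sup>* \<Longrightarrow> d y \<le> C * (d x + D)"
    using rtrancl_affine_bound[of c E] c by (metis less_imp_le)
  have Q: "d y \<le> c * (\<Sum>y\<in>UNIV. Q \<theta> x y * d y)" if \<theta>: "\<theta> \<ge> 0" and d: "\<And>x. d x \<ge> 0" and e: "(x, y) \<in> E" for \<theta> d x y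
  proof -
    have xy: "P $ x $ y > 0" "f y = b" using e by (auto simp: E_def)
    have rv: "rho \<theta> * v \<theta> x \<le> exp (\<theta> * b) * (K * v \<theta> y)"
      using v_pos[of \<theta> x] by (intro mult_mono rho_le[OF \<theta>] K(2)[OF \<theta>]) auto
    have "p * (rho \<theta> * v \<theta> x) \<le> P $ x $ y * (exp (\<theta> * b) * (K * v \<theta> y))"
      using v_pos[of \<theta> x] rho_pos[of \<theta>] P_nonneg by (intro mult_mono[OF p(2)[OF xy(1)] rv]) auto
    then have "1 \<le> c * Q \<theta> x y"
      using p K rho_pos[of \<theta>] v_pos[of \<theta> x] xy
      by (simp add: c_def Q_def A_def pos_le_divide_eq mult_ac)
    then have "1 * d y \<le> c * Q \<theta> x y * d y" using d by (rule mult_right_mono)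
    also have "\<dots> \<le> c * (\<Sum>y\<in>UNIV. Q \<theta> x y * d y)"
      unfolding mult.assoc using c by (intro mult_left_mono member_le_sum) (auto simp: Q_nonneg d)
    finally show ?thesis by simp
  qed
  obtain y0 where y0: "f y0 = b" using b_attained by blast
  show thesis
  proof
    show "2 * C * (b - a) \<ge> 0" using C ab by simp
    fix \<theta> x y assume \<theta>: "\<theta> \<ge> (0::real)"
    define l where "l = drho \<theta> / rho \<theta>"
    have pois: "(\<Sum>y\<in>UNIV. Q \<theta> x y * w \<theta> y) = l + w \<theta> x - (\<Sum>y\<in>UNIV. Q \<theta> x y * f y)" for x
      using poisson[of \<theta> x] by (simp add: l_def distrib_left sum.distrib)
    have "Max (range (w \<theta>)) \<in> range (w \<theta>)" by (rule Max_in) auto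
    then obtain i where "Max (range (w \<theta>)) = w \<theta> i" by blast
    then have i: "w \<theta> y \<le> w \<theta> i" for y by (metis Max_ge finite UNIV_I finite_imageI image_eqI)
    have "Min (range (w \<theta>)) \<in> range (w \<theta>)" by (rule Min_in) auto
    then obtain j where "Min (range (w \<theta>)) = w \<theta> j" by blast
    then have j: "w \<theta> j \<le> w \<theta> y" for y by (metis Min_le finite UNIV_I finite_imageI image_eqI)
    have up: "(\<Sum>y\<in>UNIV. Q \<theta> x y * (w \<theta> i - w \<theta> y)) = w \<theta> i - w \<theta> x + ((\<Sum>y\<in>UNIV. Q \<theta> x y * f y) - l)" for x
      by (simp add: right_diff_distrib sum_subtractf Q_row pois flip: sum_distrib_right)
    have lo: "(\<Sum>y\<in>UNIV. Q \<theta> x y * (w \<theta> y - w \<theta> j)) = w \<theta> x - w \<theta> j + (l - (\<Sum>y\<in>UNIV. Q \<theta> x y * f y))" for x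
      by (simp add: right_diff_distrib sum_subtractf Q_row pois flip: sum_distrib_right)
    \<comment> \<open>Maximum principle: at a maximiser of w the Poisson equation bounds
      \<open>l\<close> by a Q-average of f; the minimiser gives the opposite bound.\<close>
    have "0 \<le> (\<Sum>y\<in>UNIV. Q \<theta> i y * (w \<theta> i - w \<theta> y))" using i by (intro sum_nonneg) (simp add: Q_nonneg)
    then have lb: "l \<le> b" using up[of i] sum_Q_f(2)[of \<theta> i] by simp
    have "0 \<le> (\<Sum>y\<in>UNIV. Q \<theta> j y * (w \<theta> y - w \<theta> j))" using j by (intro sum_nonneg) (simp add: Q_nonneg)
    then have la: "a \<le> l" using lo[of j] sum_Q_f(1)[of \<theta> j] by simp
    have 1: "w \<theta> i - w \<theta> y0 \<le> C * ((w \<theta> i - w \<theta> i) + (b - a))"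
    proof (rule C(2)[of "b - a" "\<lambda>x. w \<theta> i - w \<theta> x"])
      show "(i, y0) \<in> E\<^sup>*" by (rule path_E[OF y0])
      fix x y assume "(x, y) \<in> E"
      then have "w \<theta> i - w \<theta> y \<le> c * (\<Sum>y\<in>UNIV. Q \<theta> x y * (w \<theta> i - w \<theta> y))"
        using i by (intro Q[OF \<theta>, of "\<lambda>x. w \<theta> i - w \<theta> x"]) auto
      also have "\<dots> \<le> c * (w \<theta> i - w \<theta> x + (b - a))"
        using c sum_Q_f(2)[of \<theta> x] la unfolding up by simp
      finally show "w \<theta> i - w \<theta> y \<le> c * (w \<theta> i - w \<theta> x + (b - a))" .
    qed (use ab i in auto)
    have 2: "w \<theta> y0 - w \<theta> j \<le> C * ((w \<theta> j - w \<theta> j) + (b - a))"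
    proof (rule C(2)[of "b - a" "\<lambda>x. w \<theta> x - w \<theta> j"])
      show "(j, y0) \<in> E\<^sup>*" by (rule path_E[OF y0])
      fix x y assume "(x, y) \<in> E"
      then have "w \<theta> y - w \<theta> j \<le> c * (\<Sum>y\<in>UNIV. Q \<theta> x y * (w \<theta> y - w \<theta> j))"
        using j by (intro Q[OF \<theta>, of "\<lambda>x. w \<theta> x - w \<theta> j"]) auto
      also have "\<dots> \<le> c * (w \<theta> x - w \<theta> j + (b - a))"
        using c sum_Q_f(1)[of \<theta> x] lb unfolding lo by simp
      finally show "w \<theta> y - w \<theta> j \<le> c * (w \<theta> x - w \<theta> j + (b - a))" .
    qed (use ab j in auto)
    show "\<bar>w \<theta> x - w \<theta> y\<bar> \<le> 2 * C * (b - a)"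
      using 1 2 i[of x] i[of y] j[of x] j[of y] by simp
  qed
qed

section \<open>Finiteness of the suprema and the one-sided estimate\<close>

lemma bdd_above_K_set: "bdd_above (K_set P f)"
proof -
  obtain K where K: "K > 0" "\<And>\<theta> x y. \<theta> \<ge> 0 \<Longrightarrow> v \<theta> y \<le> K * v \<theta> x" using v_ratio_bounded by blast
  show ?thesis
    unfolding K_set_def perron_ratio_eq
    by (intro bdd_aboveI[of _ K]) (auto simp: pos_divide_le_eq v_pos intro: K)
qed

lemma bdd_above_L_set: "bdd_above (L_set P f)"
proof -
  obtain K where K: "K > 0" "\<And>\<theta> x y. \<theta> \<ge> 0 \<Longrightarrow> v \<theta> y \<le> K * v \<theta> x" using v_ratio_bounded by blast
  obtain L where L: "L \<ge> 0" "\<And>\<theta> x y. \<theta> \<ge> 0 \<Longrightarrow> \<bar>w \<theta> x - w \<theta> y\<bar> \<le> L" using w_osc_bounded by blast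
  have "\<bar>v \<theta> x / v \<theta> y * (w \<theta> x - w \<theta> y)\<bar> \<le> K * L" if "\<theta> \<ge> 0" for \<theta> x y
  proof -
    have "\<bar>v \<theta> x / v \<theta> y\<bar> \<le> K"
      using K(2)[OF that, of x y] v_pos[of \<theta> x] v_pos[of \<theta> y] by (simp add: pos_divide_le_eq)
    then show ?thesis unfolding abs_mult using L(2)[OF that] K(1) by (intro mult_mono) auto
  qed
  then show ?thesis
    unfolding L_set_def perron_ratio_deriv by (intro bdd_aboveI[of _ "K * L"]) auto
qed

lemma K_u_ge: "\<theta> \<ge> 0 \<Longrightarrow> v \<theta> x / v \<theta> y \<le> K_u P f"
  unfolding K_u_def by (intro cSup_upper bdd_above_K_set) (auto simp: K_set_def perron_ratio_eq)

lemma L_u_ge: "\<theta> \<ge> 0 \<Longrightarrow> \<bar>v \<theta> x / v \<theta> y * (w \<theta> x - w \<theta> y)\<bar> \<le> L_u P f"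
  unfolding L_u_def by (intro cSup_upper bdd_above_L_set) (auto simp: L_set_def perron_ratio_deriv)

lemma K_u_nonneg: "K_u P f \<ge> 0" and L_u_nonneg: "L_u P f \<ge> 0"
  using K_u_ge[of 0 r r] L_u_ge[of 0 r r] by auto

lemma w_diff_le:
  assumes "\<theta> \<ge> 0"
  shows "w \<theta> x - w \<theta> y \<le> K_u P f * L_u P f"
proof -
  have "w \<theta> x - w \<theta> y = v \<theta> y / v \<theta> x * (v \<theta> x / v \<theta> y * (w \<theta> x - w \<theta> y))" by simp
  also have "\<dots> \<le> \<bar>v \<theta> y / v \<theta> x * (v \<theta> x / v \<theta> y * (w \<theta> x - w \<theta> y))\<bar>" by (rule abs_ge_self)
  also have "\<dots> = v \<theta> y / v \<theta> x * \<bar>v \<theta> x / v \<theta> y * (w \<theta> x - w \<theta> y)\<bar>"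
    using v_pos[of \<theta> x] v_pos[of \<theta> y] by (simp add: abs_mult)
  also have "\<dots> \<le> K_u P f * L_u P f"
    by (intro mult_mono K_u_ge L_u_ge assms K_u_nonneg) auto
  finally show ?thesis .
qed

lemma var_set_le:
  assumes "s \<in> var_set P f"
  shows "s \<le> (b - a + K_u P f * L_u P f)\<^sup>2 / 4"
proof -
  obtain \<theta> where \<theta>: "\<theta> \<ge> 0" "s = deriv (deriv (Lambda P f)) \<theta>" using assms by (auto simp: var_set_def)
  have "(f x + w \<theta> x) - (f y + w \<theta> y) \<le> b - a + K_u P f * L_u P f" for x y
    using w_diff_le[OF \<theta>(1), of x y] a_le[of y] le_b[of x] by linarith
  then show ?thesis unfolding \<theta>(2) by (rule Lambda2_le)
qed

lemma bdd_above_var_set: "bdd_above (var_set P f)"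
  using var_set_le by (rule bdd_aboveI)

lemma sigma2_u_le: "sigma2_u P f \<le> (b - a + K_u P f * L_u P f)\<^sup>2 / 4"
  unfolding sigma2_u_def
proof (rule cSup_least)
  show "var_set P f \<noteq> {}" by (auto simp: var_set_def)
qed (rule var_set_le)

text \<open>Second-order Taylor expansion at 0, where Lambda vanishes and its slope is the mean of
  f. The intermediate point is positive, so the supremum over \<theta> >= 0 bounds the remainder.
  Zero is split off because \<open>Maclaurin\<close> needs a positive endpoint.\<close>

lemma Lambda_le:
  assumes \<pi>: "stationary P \<pi>" and \<theta>: "\<theta> \<ge> 0"
  shows "Lambda P f \<theta> \<le> mean \<pi> f * \<theta> + 1 / 2 * sigma2_u P f * \<theta>\<^sup>2"
proof (cases "\<theta> = 0")
  case True
  then show ?thesis by (simp add: Lambda_eq rho_zero)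
next
  case False
  define \<Phi> where "\<Phi> m = (if m = 0 then Lambda P f else if m = 1 then \<lambda>\<theta>. drho \<theta> / rho \<theta>
    else deriv (deriv (Lambda P f)))" for m :: nat
  have "(\<Phi> m has_real_derivative \<Phi> (Suc m) t) (at t)" if "m < 2" for m t
  proof (cases "m = 0")
    case True
    then show ?thesis using Lambda_deriv by (simp add: \<Phi>_def)
  next
    case False
    then have "m = 1" using that by simp
    then show ?thesis using dLambda_deriv[of t] by (simp add: \<Phi>_def deriv2_Lambda)
  qed
  then obtain t where t: "0 < t" "Lambda P f \<theta> = (\<Sum>m<2. \<Phi> m 0 / fact m * \<theta> ^ m) + \<Phi> 2 t / fact 2 * \<theta>\<^sup>2"
    using Maclaurin[of \<theta> 2 \<Phi> "Lambda P f"] False \<theta> by (auto simp: \<Phi>_def)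
  have "Lambda P f \<theta> = mean \<pi> f * \<theta> + 1 / 2 * deriv (deriv (Lambda P f)) t * \<theta>\<^sup>2"
    unfolding t(2) using drho_zero[OF \<pi>]
    by (simp add: \<Phi>_def numeral_2_eq_2 Lambda_eq rho_zero)
  moreover have "deriv (deriv (Lambda P f)) t \<le> sigma2_u P f"
    unfolding sigma2_u_def using t(1)
    by (intro cSup_upper bdd_above_var_set) (auto simp: var_set_def intro!: exI[of _ t])
  ultimately show ?thesis by (simp add: mult_right_mono)
qed

end

section \<open>Reflection of the tilt and conclusion\<close>

lemma Lambda_uminus: "Lambda P (\<lambda>x. - f x) \<theta> = Lambda P f (- \<theta>)"
  by (simp add: Lambda_def tilted_def)

lemma mean_uminus: "mean \<pi> (\<lambda>x. - f x) = - mean \<pi> f"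
  by (simp add: mean_def sum_negf)

theorem lemma9:
  fixes P :: "real^'s::finite^'s" and \<pi> :: "real^'s" and f :: "'s \<Rightarrow> real"
    and a b \<sigma>2 K L :: real and Sa Sb :: "'s set"
  assumes "stochastic P"
    and "irreducible_on UNIV P"
    and "stationary P \<pi>"
    and "a = Min (range f)"
    and "b = Max (range f)"
    and "Sa = {x. f x = a}"
    and "Sb = {x. f x = b}"
    and "irreducible_on Sb P"
    and "\<forall>x\<in>UNIV - Sb. \<exists>y\<in>Sb. P $ x $ y > 0"
    and "irreducible_on Sa P"
    and "\<forall>x\<in>UNIV - Sa. \<exists>y\<in>Sa. P $ x $ y > 0"
    and "\<sigma>2 = max (sigma2_u P f) (sigma2_u P (\<lambda>x. - f x))"
    and "K = max (K_u P f) (K_u P (\<lambda>x. - f x))"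
    and "L = max (L_u P f) (L_u P (\<lambda>x. - f x))"
  shows "bdd_above (var_set P f) \<and> bdd_above (var_set P (\<lambda>x. - f x)) \<and>
         bdd_above (K_set P f) \<and> bdd_above (K_set P (\<lambda>x. - f x)) \<and>
         bdd_above (L_set P f) \<and> bdd_above (L_set P (\<lambda>x. - f x)) \<and>
         (\<forall>\<theta>::real. Lambda P f \<theta> \<le> mean \<pi> f * \<theta> + 1/2 * \<sigma>2 * \<theta>\<^sup>2 \<and>
            mean \<pi> f * \<theta> + 1/2 * \<sigma>2 * \<theta>\<^sup>2
              \<le> mean \<pi> f * \<theta> + (b - a + 2 * K * L)\<^sup>2 / 8 * \<theta>\<^sup>2)"
proof -
  have ab: "a \<in> range f" "b \<in> range f" "a \<le> f x" "f x \<le> b" for x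
    unfolding assms(4,5) by (auto intro!: Min_in Max_in)
  \<comment> \<open>Any state may serve as base point, hence \<open>undefined\<close>.\<close>
  interpret up: extremal_chain P f undefined a b
  proof
    show "\<exists>y. f y = b \<and> P $ x $ y > 0" if "f x \<noteq> b" for x using that assms(7,9) by blast
  qed (use assms ab in \<open>auto simp: image_iff\<close>)
  have Sa: "{x. - f x = - a} = Sa" using assms(6) by auto
  interpret down: extremal_chain P "\<lambda>x. - f x" undefined "- b" "- a"
  proof
    show "\<exists>y. - f y = - a \<and> P $ x $ y > 0" if "- f x \<noteq> - a" for x using that assms(6,11) by auto
    show "irreducible_on {x. - f x = - a} P" unfolding Sa by (rule assms(10))
  qed (use assms(1,2) ab in \<open>auto simp: image_iff\<close>)
  \<comment> \<open>Each one-sided product is at most KL, and KL <= 2KL by nonnegativity.\<close>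
  have KL: "K_u P f * L_u P f \<le> 2 * K * L" "K_u P (\<lambda>x. - f x) * L_u P (\<lambda>x. - f x) \<le> 2 * K * L"
  proof -
    have nn: "0 \<le> K" "0 \<le> L" using up.K_u_nonneg up.L_u_nonneg assms(13,14) by auto
    have "K_u P f * L_u P f \<le> K * L" "K_u P (\<lambda>x. - f x) * L_u P (\<lambda>x. - f x) \<le> K * L"
      using assms(13,14) nn up.L_u_nonneg down.L_u_nonneg by (auto intro!: mult_mono)
    then show "K_u P f * L_u P f \<le> 2 * K * L" "K_u P (\<lambda>x. - f x) * L_u P (\<lambda>x. - f x) \<le> 2 * K * L"
      using mult_nonneg_nonneg[OF nn] by linarith+
  qed
  have "sigma2_u P f \<le> (b - a + 2 * K * L)\<^sup>2 / 4"
  proof -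
    have "(b - a + K_u P f * L_u P f)\<^sup>2 \<le> (b - a + 2 * K * L)\<^sup>2"
      using KL(1) up.ab up.K_u_nonneg up.L_u_nonneg by (intro power_mono) auto
    then show ?thesis using up.sigma2_u_le by linarith
  qed
  moreover have "sigma2_u P (\<lambda>x. - f x) \<le> (b - a + 2 * K * L)\<^sup>2 / 4"
  proof -
    \<comment> \<open>For -f the range is from -b to -a, of the same length b - a.\<close>
    have "(- a - - b + K_u P (\<lambda>x. - f x) * L_u P (\<lambda>x. - f x))\<^sup>2 \<le> (b - a + 2 * K * L)\<^sup>2"
      using KL(2) up.ab down.K_u_nonneg down.L_u_nonneg by (intro power_mono) auto
    then show ?thesis using down.sigma2_u_le by linarith
  qed
  ultimately have "\<sigma>2 \<le> (b - a + 2 * K * L)\<^sup>2 / 4" using assms(12) by simp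
  then have second: "1/2 * \<sigma>2 * \<theta>\<^sup>2 \<le> (b - a + 2 * K * L)\<^sup>2 / 8 * \<theta>\<^sup>2" for \<theta> :: real
    by (intro mult_right_mono) auto
  have first: "Lambda P f \<theta> \<le> mean \<pi> f * \<theta> + 1/2 * \<sigma>2 * \<theta>\<^sup>2" for \<theta>
  proof (cases "\<theta> \<ge> 0")
    case True
    have "1/2 * sigma2_u P f * \<theta>\<^sup>2 \<le> 1/2 * \<sigma>2 * \<theta>\<^sup>2" using assms(12) by (intro mult_right_mono) auto
    then show ?thesis using up.Lambda_le[OF assms(3) True] by linarith
  next
    case False
    have "1/2 * sigma2_u P (\<lambda>x. - f x) * \<theta>\<^sup>2 \<le> 1/2 * \<sigma>2 * \<theta>\<^sup>2" using assms(12) by (intro mult_right_mono) auto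
    \<comment> \<open>Reflection turns the tilt \<theta> of f into the positive tilt -\<theta> of
      -f; the linear term is unchanged because the mean changes sign too.\<close>
    moreover have "Lambda P f \<theta> \<le> mean \<pi> f * \<theta> + 1/2 * sigma2_u P (\<lambda>x. - f x) * \<theta>\<^sup>2"
      using down.Lambda_le[OF assms(3), of "- \<theta>"] False by (simp add: Lambda_uminus mean_uminus)
    ultimately show ?thesis by linarith
  qed
  show ?thesis
    using up.bdd_above_var_set down.bdd_above_var_set up.bdd_above_K_set down.bdd_above_K_set
      up.bdd_above_L_set down.bdd_above_L_set first second by simp
qed

end
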